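(* There is an absolute constant $c>0$ such that for every finite set $A\subset\mathbb{C}$ with at least two elements, $$|A-A|+|A:A|\ \ge\ c\,\frac{|A|^{1+\frac{9}{31}}}{\log^{\frac{4}{31}}|A|}\qquad\text{and}\qquad |A-A|+|A\cdot A|\ \ge\ c\,\frac{|A|^{1+\frac{11}{39}}}{\log^{\frac{5}{13}}|A|}.$$
   Context: For a finite set $A\subset\mathbb{C}$: $A-A=\{a_1-a_2: a_1,a_2\in A\}$, $A\cdot A=\{a_1a_2: a_1,a_2\in A\}$, and $A:A=\{a_1/a_2: a_1,a_2\in A,\ a_2\neq 0\}$. The constant $c$ does not depend on $A$. *)

theory Defs
  imports Complex_Main
begin

text \<open>
  On the type of sets, \<open>A - A\<close> denotes set-theoretic difference, so the set of
  differences gets a name of its own.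
\<close>

definition difference_set :: "complex set \<Rightarrow> complex set" where
  "difference_set A = {a1 - a2 | a1 a2. a1 \<in> A \<and> a2 \<in> A}"

definition product_set :: "complex set \<Rightarrow> complex set" where
  "product_set A = {a1 * a2 | a1 a2. a1 \<in> A \<and> a2 \<in> A}"

definition ratio_set :: "complex set \<Rightarrow> complex set" where
  "ratio_set A = {a1 / a2 | a1 a2. a1 \<in> A \<and> a2 \<in> A \<and> a2 \<noteq> 0}"

end

theory Submission
  imports Defs "HOL-Analysis.Harmonic_Numbers"
begin

text \<open>
  Let \<open>n = |A|\<close> with \<open>0 \<notin> A\<close>, let \<open>D\<close> be the difference set, \<open>d = |D|\<close>, and let \<open>p\<close> be the size
  of the product set or of the ratio set.  Up to powers of \<open>log n\<close> one has
  \<open>n\<^sup>2\<^sup>2 \<le> p\<^sup>7 d\<^sup>1\<^sup>0\<close>, hence \<open>max p d \<ge> n\<^bsup>1 + 5/17\<^esup>\<close>, and \<open>5/17\<close> exceeds both \<open>9/31\<close> and \<open>11/39\<close>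
  so that all logarithms can be absorbed.

  The only geometric input is the Szemeredi--Trotter bound for complex lines and Cartesian
  products, which follows from comparing each point on a rich line with its nearest neighbour on
  that line.

  Let \<open>r w\<close> be the number of representations of \<open>w\<close> as a difference in \<open>A\<close>, and let \<open>E\<close> be the
  number of solutions of \<open>a - z = a' - z'\<close> with \<open>a, a' \<in> A\<close> and \<open>z, z' \<in> D\<close>.  The
  Schoen--Shkredov inequality gives \<open>n\<^sup>8 \<le> 8 d (\<Sum>w. r w ^ 3) E\<close>.  Since \<open>A\<close> has few products,
  the lines \<open>x = q u - z\<close> with \<open>q\<close> a product and \<open>z \<in> D\<close> yield \<open>E\<^sup>2 \<le> p\<^sup>2 d\<^sup>3\<close>.
  For the third moment let \<open>W\<close> be the set of differences with at least \<open>\<tau>\<close> representations.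
  The lines with slope a popular ratio \<open>q\<close> and intercept \<open>q b - b'\<close>, \<open>b, b' \<in> A\<close>, are rich both
  in \<open>W \<times> W\<close> and, after reflection, in \<open>A \<times> A\<close>; applying the incidence bound to both grids gives
  \<open>|W|\<^sup>4 \<tau>\<^sup>1\<^sup>2 \<le> p\<^sup>3 n\<^sup>1\<^sup>0\<close>.
\<close>

section \<open>Incidences of complex lines with Cartesian products\<close>

text \<open>The unit vectors from \<open>z\<close> to the points of \<open>T\<close> are pairwise at distance at least 1.\<close>

lemma card_le_if_closer_to_center:
  fixes z :: complex
  assumes "finite T" and far: "\<And>s t. s \<in> T \<Longrightarrow> t \<in> T \<Longrightarrow> s \<noteq> t \<Longrightarrow> dist z t \<le> dist s t"
  shows "card T \<le> 26"
proof -
  define u where "u t = sgn (t - z)" for t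
  define cell where "cell t = (\<lfloor>2 * Re (u t)\<rfloor>, \<lfloor>2 * Im (u t)\<rfloor>)" for t
  have nu: "norm (u t) \<le> 1" for t
    by (simp add: u_def norm_sgn)
  have dec: "t - z = of_real (norm (t - z)) * u t" for t
    by (simp add: u_def sgn_eq)
  have key: "norm (u s - u t) \<ge> 1"
    if "s \<in> T" "t \<in> T" "s \<noteq> t" "s \<noteq> z" "t \<noteq> z" "norm (s - z) \<le> norm (t - z)" for s t
  proof (rule ccontr)
    assume "\<not> ?thesis"
    then have lt: "norm (u t - u s) < 1" by (simp add: norm_minus_commute)
    have "t - s = of_real (norm (t - z) - norm (s - z)) * u t + of_real (norm (s - z)) * (u t - u s)"
      (is "_ = ?r")
    proof -
      have "?r = of_real (norm (t - z)) * u t - of_real (norm (s - z)) * u s"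
        by (simp add: algebra_simps)
      also have "\<dots> = (t - z) - (s - z)" by (simp only: dec[symmetric])
      finally show ?thesis by simp
    qed
    then have "norm (t - s) \<le> norm (of_real (norm (t - z) - norm (s - z)) * u t) + norm (of_real (norm (s - z)) * (u t - u s))"
      using norm_triangle_ineq by metis
    also have "\<dots> = (norm (t - z) - norm (s - z)) * norm (u t) + norm (s - z) * norm (u t - u s)"
      using that(6) by (simp only: norm_mult norm_of_real) simp
    also have "\<dots> < (norm (t - z) - norm (s - z)) * 1 + norm (s - z) * 1"
      using that(4,6) lt nu[of t] by (intro add_le_less_mono mult_left_mono mult_strict_left_mono) auto
    finally show False
      using far[OF that(1,2,3)] by (simp add: dist_norm norm_minus_commute)
  qed
  have "inj_on cell (T - {z})"
  proof (rule inj_onI, rule ccontr)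
    fix s t assume st: "s \<in> T - {z}" "t \<in> T - {z}" "cell s = cell t" "s \<noteq> t"
    have "norm (u s - u t) \<ge> 1"
      using key[of s t] key[of t s] st by (cases "norm (s - z) \<le> norm (t - z)") (auto simp: norm_minus_commute)
    moreover have "\<bar>Re (u s) - Re (u t)\<bar> < 1/2" "\<bar>Im (u s) - Im (u t)\<bar> < 1/2"
      using st(3) unfolding cell_def prod.inject by linarith+
    moreover have "norm (u s - u t) \<le> \<bar>Re (u s) - Re (u t)\<bar> + \<bar>Im (u s) - Im (u t)\<bar>"
      using cmod_le[of "u s - u t"] by simp
    ultimately show False by linarith
  qed
  moreover have "cell ` (T - {z}) \<subseteq> {-2..2} \<times> {-2..2}"
  proof -
    have "\<lfloor>2 * x\<rfloor> \<in> {-2..2}" if "\<bar>x\<bar> \<le> 1" for x :: real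
      using that by (auto simp: floor_le_iff le_floor_iff)
    moreover have "\<bar>Re (u t)\<bar> \<le> 1" "\<bar>Im (u t)\<bar> \<le> 1" for t
      using nu[of t] abs_Re_le_cmod[of "u t"] abs_Im_le_cmod[of "u t"] by linarith+
    ultimately show ?thesis by (auto simp: cell_def)
  qed
  ultimately have "card (T - {z}) \<le> card ({-2..2::int} \<times> {-2..2::int})"
    by (intro card_inj_on_le[of cell]) auto
  then have "card (T - {z}) \<le> 25" by (simp add: card_cartesian_product)
  then show ?thesis
    using \<open>finite T\<close> by (cases "z \<in> T") (auto simp: card_Diff_singleton)
qed

lemma card_large_le:
  fixes g :: "'a \<Rightarrow> nat"
  assumes "finite T" "(\<Sum>t\<in>T. g t) \<le> S" "S > 0"
  shows "4 * card {t \<in> T. card T * g t > 4 * S} \<le> card T"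
proof -
  let ?B = "{t \<in> T. card T * g t > 4 * S}"
  have "card ?B * (4 * S) \<le> (\<Sum>t\<in>?B. card T * g t)"
    using sum_mono[of ?B "\<lambda>_. 4 * S" "\<lambda>t. card T * g t"] by simp
  also have "\<dots> \<le> (\<Sum>t\<in>T. card T * g t)"
    using assms(1) by (intro sum_mono2) auto
  also have "\<dots> \<le> card T * S"
    using assms(2) by (simp add: sum_distrib_left[symmetric])
  finally show ?thesis using assms(3) by simp
qed

lemma sum_card_swap:
  assumes "finite S" "finite T"
  shows "(\<Sum>x\<in>S. card {y \<in> T. R x y}) = (\<Sum>y\<in>T. card {x \<in> S. R x y})"
  by (simp only: card_eq_sum sum.swap_restrict[OF assms])

lemma sum_card_nearest_ball_le:
  fixes U T :: "complex set" and \<nu> :: "complex \<Rightarrow> complex"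
  assumes "finite U" "finite T"
    and nearest: "\<And>s t. s \<in> T \<Longrightarrow> t \<in> T \<Longrightarrow> s \<noteq> t \<Longrightarrow> dist t (\<nu> t) \<le> dist s t"
  shows "(\<Sum>t\<in>T. card (U \<inter> cball t (dist t (\<nu> t)))) \<le> 26 * card U"
proof -
  have "(\<Sum>t\<in>T. card (U \<inter> cball t (dist t (\<nu> t)))) = (\<Sum>t\<in>T. card {z \<in> U. dist z t \<le> dist t (\<nu> t)})"
    by (intro sum.cong refl arg_cong[of _ _ card]) (auto simp: dist_commute)
  also have "\<dots> = (\<Sum>z\<in>U. card {t \<in> T. dist z t \<le> dist t (\<nu> t)})"
    using assms by (intro sum_card_swap)
  also have "\<dots> \<le> (\<Sum>z\<in>U. 26)"
  proof (rule sum_mono)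
    fix z
    show "card {t \<in> T. dist z t \<le> dist t (\<nu> t)} \<le> 26"
    proof (rule card_le_if_closer_to_center)
      fix s t assume "s \<in> {t \<in> T. dist z t \<le> dist t (\<nu> t)}" "t \<in> {t \<in> T. dist z t \<le> dist t (\<nu> t)}" "s \<noteq> t"
      then show "dist z t \<le> dist s t" using nearest[of s t] by simp
    qed (use assms(2) in simp)
  qed
  finally show ?thesis by simp
qed

text \<open>The constant is \<open>4 \<cdot> 26\<close>: a covering multiplicity of 26, exceeded fourfold by at most a
  quarter of the points.\<close>

definition near_pairs :: "nat \<Rightarrow> complex set \<Rightarrow> (complex \<times> complex) set" where
  "near_pairs k U = {(x, y) \<in> U \<times> U. k * card (U \<inter> cball x (dist x y)) \<le> 104 * card U}"

lemma finite_near_pairs: "finite U \<Longrightarrow> finite (near_pairs k U)"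
  by (rule finite_subset[of _ "U \<times> U"]) (auto simp: near_pairs_def)

lemma card_near_pairs_le:
  assumes "finite U"
  shows "k * card (near_pairs k U) \<le> 104 * (card U)\<^sup>2"
proof -
  define F where "F x = {y \<in> U. k * card (U \<inter> cball x (dist x y)) \<le> 104 * card U}" for x
  have fin: "finite (F x)" for x using assms by (simp add: F_def)
  have F: "k * card (F x) \<le> 104 * card U" for x
  proof (cases "F x = {}")
    case False
    obtain y where y: "y \<in> F x" "\<And>y'. y' \<in> F x \<Longrightarrow> dist x y' \<le> dist x y"
      using obtains_MAX[OF fin False, of "dist x"] Max_ge[OF finite_imageI[OF fin]] by (metis imageI)
    then have "F x \<subseteq> U \<inter> cball x (dist x y)" by (auto simp: F_def)
    then have "card (F x) \<le> card (U \<inter> cball x (dist x y))" using assms by (intro card_mono) auto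
    then have "k * card (F x) \<le> k * card (U \<inter> cball x (dist x y))" by simp
    also have "\<dots> \<le> 104 * card U" using y(1) by (simp add: F_def)
    finally show ?thesis .
  qed simp
  have "near_pairs k U = Sigma U F" by (auto simp: near_pairs_def F_def)
  then have "k * card (near_pairs k U) = (\<Sum>x\<in>U. k * card (F x))"
    using assms fin by (simp add: sum_distrib_left)
  also have "\<dots> \<le> (\<Sum>x\<in>U. 104 * card U)" by (intro sum_mono F)
  finally show ?thesis by (simp add: power2_eq_square)
qed

text \<open>A pair \<open>(m, c)\<close> stands for the line \<open>y = m x + c\<close>.\<close>

definition rich :: "complex set \<Rightarrow> complex set \<Rightarrow> complex \<times> complex \<Rightarrow> nat" where
  "rich U V l = card {x \<in> U. fst l * x + snd l \<in> V}"

lemma near_pairs_on_line: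
  fixes l :: "complex \<times> complex"
  assumes "finite U" "finite V" "fst l \<noteq> 0" "2 \<le> k" "k \<le> rich U V l"
  shows "\<exists>\<nu> G. G \<subseteq> U \<and> rich U V l \<le> 2 * card G \<and>
    (\<forall>t\<in>G. \<nu> t \<noteq> t \<and> (t, \<nu> t) \<in> near_pairs k U \<and>
      (fst l * t + snd l, fst l * \<nu> t + snd l) \<in> near_pairs k V)"
proof -
  define f where "f x = fst l * x + snd l" for x
  define T where "T = {x \<in> U. f x \<in> V}"
  have cT: "card T = rich U V l" by (simp add: T_def rich_def f_def)
  have finT: "finite T" using assms(1) by (simp add: T_def)
  have injf: "inj f" using assms(3) by (auto simp: inj_def f_def)
  have df: "dist (f x) (f y) = norm (fst l) * dist x y" for x y
    by (simp add: f_def dist_norm norm_mult[symmetric] algebra_simps)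
  have "\<exists>s. s \<in> T - {t} \<and> (\<forall>s'\<in>T - {t}. dist t s \<le> dist s' t)" if "t \<in> T" for t
  proof -
    have "card (T - {t}) \<noteq> 0" using assms(4,5) cT that finT by simp
    then have ne: "T - {t} \<noteq> {}" by (metis card.empty)
    then obtain s where "s \<in> T - {t}" "dist s t = Min ((\<lambda>s. dist s t) ` (T - {t}))"
      using obtains_MIN[of "T - {t}" "\<lambda>s. dist s t"] finT by (metis finite_Diff)
    then show ?thesis
      using finT by (intro exI[of _ s]) (auto simp: dist_commute[of t s] intro!: Min_le)
  qed
  then obtain \<nu> where \<nu>: "\<And>t. t \<in> T \<Longrightarrow> \<nu> t \<in> T - {t}"
      "\<And>s t. t \<in> T \<Longrightarrow> s \<in> T - {t} \<Longrightarrow> dist t (\<nu> t) \<le> dist s t"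
    by metis
  define g1 where "g1 t = card (U \<inter> cball t (dist t (\<nu> t)))" for t
  define g2 where "g2 t = card (V \<inter> cball (f t) (dist (f t) (f (\<nu> t))))" for t
  have s1: "(\<Sum>t\<in>T. g1 t) \<le> 26 * card U"
    unfolding g1_def using \<nu> by (intro sum_card_nearest_ball_le assms finT) auto
  have s2: "(\<Sum>t\<in>T. g2 t) \<le> 26 * card V"
  proof -
    have inv: "inv f (f x) = x" for x using injf by simp
    have "(\<Sum>t\<in>T. g2 t) = (\<Sum>y\<in>f ` T. card (V \<inter> cball y (dist y (f (\<nu> (inv f y))))))"
      using injf by (subst sum.reindex) (auto simp: inj_on_def inj_def g2_def)
    also have "\<dots> \<le> 26 * card V"
    proof (rule sum_card_nearest_ball_le)
      fix s t assume "s \<in> f ` T" "t \<in> f ` T" "s \<noteq> t"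
      then obtain s' t' where "s = f s'" "t = f t'" "s' \<in> T" "t' \<in> T" "s' \<noteq> t'" by auto
      then show "dist t (f (\<nu> (inv f t))) \<le> dist s t"
        using \<nu>(2)[of t' s'] by (simp add: inv df mult_left_mono)
    qed (use assms finT in auto)
    finally show ?thesis .
  qed
  have "T \<noteq> {}" using assms(4,5) cT by auto
  then have "U \<noteq> {}" "V \<noteq> {}" by (auto simp: T_def)
  then have pos: "26 * card U > 0" "26 * card V > 0" using assms by auto
  define B1 where "B1 = {t \<in> T. card T * g1 t > 4 * (26 * card U)}"
  define B2 where "B2 = {t \<in> T. card T * g2 t > 4 * (26 * card V)}"
  have "4 * card B1 \<le> card T" "4 * card B2 \<le> card T"
    unfolding B1_def B2_def using card_large_le[OF finT s1 pos(1)] card_large_le[OF finT s2 pos(2)] by auto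
  moreover have "card (B1 \<union> B2) \<le> card B1 + card B2" by (rule card_Un_le)
  moreover have "card (T - (B1 \<union> B2)) = card T - card (B1 \<union> B2)"
    using finT by (intro card_Diff_subset) (auto simp: B1_def B2_def)
  ultimately have half: "card T \<le> 2 * card (T - (B1 \<union> B2))" by linarith
  have le: "k * x \<le> C" if "card T * x \<le> C" for x C
    using that assms(5) cT by (metis le_trans mult_le_mono1)
  show ?thesis
  proof (intro exI[of _ \<nu>] exI[of _ "T - (B1 \<union> B2)"] conjI ballI)
    show "T - (B1 \<union> B2) \<subseteq> U" by (auto simp: T_def)
    show "rich U V l \<le> 2 * card (T - (B1 \<union> B2))" using half cT by simp
  next
    fix t assume t: "t \<in> T - (B1 \<union> B2)"
    then have tT: "t \<in> T" "\<nu> t \<in> T" using \<nu>(1) by auto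
    show "\<nu> t \<noteq> t" using \<nu>(1) t by auto
    have "card T * g1 t \<le> 104 * card U" "card T * g2 t \<le> 104 * card V"
      using t by (auto simp: B1_def B2_def)
    then have "k * g1 t \<le> 104 * card U" "k * g2 t \<le> 104 * card V" using le by auto
    then show "(t, \<nu> t) \<in> near_pairs k U"
      "(fst l * t + snd l, fst l * \<nu> t + snd l) \<in> near_pairs k V"
      using tT by (auto simp: near_pairs_def g1_def g2_def T_def f_def)
  qed
qed

text \<open>On a line with many points of \<open>U \<times> V\<close>, most points have their nearest neighbour among
  the points on the line close by in \<open>U\<close> and in \<open>V\<close> in the sense of rank by distance.  There
  are few such pairs of points, and each pair determines the line.\<close>

theorem card_rich_lines_le:
  assumes "finite U" "finite V" "finite \<Lambda>" "2 \<le> k"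
    and rich: "\<And>l. l \<in> \<Lambda> \<Longrightarrow> fst l \<noteq> 0 \<and> k \<le> rich U V l"
  shows "card \<Lambda> * k ^ 3 \<le> 21632 * (card U)\<^sup>2 * (card V)\<^sup>2"
proof -
  define good where "good l \<nu> G \<longleftrightarrow> G \<subseteq> U \<and> rich U V l \<le> 2 * card G \<and>
    (\<forall>t\<in>G. \<nu> t \<noteq> t \<and> (t, \<nu> t) \<in> near_pairs k U \<and>
      (fst l * t + snd l, fst l * \<nu> t + snd l) \<in> near_pairs k V)" for l \<nu> G
  have "\<exists>\<nu> G. good l \<nu> G" if l: "l \<in> \<Lambda>" for l
  proof -
    show ?thesis
      unfolding good_def using assms(1,2,4) rich[OF l] by (intro near_pairs_on_line) auto
  qed
  then obtain \<nu> G where good: "\<And>l. l \<in> \<Lambda> \<Longrightarrow> good l (\<nu> l) (G l)"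
    by metis
  have G: "\<And>l. l \<in> \<Lambda> \<Longrightarrow> G l \<subseteq> U" "\<And>l. l \<in> \<Lambda> \<Longrightarrow> rich U V l \<le> 2 * card (G l)"
      "\<And>l t. l \<in> \<Lambda> \<Longrightarrow> t \<in> G l \<Longrightarrow> \<nu> l t \<noteq> t"
      "\<And>l t. l \<in> \<Lambda> \<Longrightarrow> t \<in> G l \<Longrightarrow> (t, \<nu> l t) \<in> near_pairs k U"
      "\<And>l t. l \<in> \<Lambda> \<Longrightarrow> t \<in> G l \<Longrightarrow> (fst l * t + snd l, fst l * \<nu> l t + snd l) \<in> near_pairs k V"
    using good unfolding good_def by blast+
  define \<phi> where "\<phi> = (\<lambda>(l, t). ((t, \<nu> l t), (fst l * t + snd l, fst l * \<nu> l t + snd l)))"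
  have "inj_on \<phi> (Sigma \<Lambda> G)"
  proof (rule inj_onI)
    fix x x' assume x: "x \<in> Sigma \<Lambda> G" "x' \<in> Sigma \<Lambda> G" "\<phi> x = \<phi> x'"
    obtain m c t m' c' t' where xx: "x = ((m, c), t)" "x' = ((m', c'), t')"
      by (metis surj_pair)
    have l: "(m, c) \<in> \<Lambda>" "t \<in> G (m, c)" "(m', c') \<in> \<Lambda>" "t' \<in> G (m', c')" "\<phi> ((m, c), t) = \<phi> ((m', c'), t')"
      using x by (auto simp: xx)
    define s where "s = \<nu> (m, c) t"
    have eq: "t' = t" "m * t + c = m' * t + c'" "m * s + c = m' * s + c'"
      using l(5) by (auto simp: \<phi>_def s_def)
    have "(m - m') * (s - t) = (m * s + c) - (m * t + c) - ((m' * s + c') - (m' * t + c'))"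
      by (simp add: algebra_simps)
    then have "(m - m') * (s - t) = 0" using eq(2,3) by simp
    moreover have "s \<noteq> t" using G(3) l by (auto simp: s_def)
    ultimately have "m = m'" by simp
    then show "x = x'" using eq by (auto simp: xx)
  qed
  moreover have "\<phi> ` Sigma \<Lambda> G \<subseteq> near_pairs k U \<times> near_pairs k V"
    using G(4,5) by (force simp: \<phi>_def)
  moreover have "finite (near_pairs k U \<times> near_pairs k V)"
    using assms by (simp add: finite_near_pairs)
  ultimately have "card (Sigma \<Lambda> G) \<le> card (near_pairs k U \<times> near_pairs k V)"
    by (intro card_inj_on_le[of \<phi>]) auto
  moreover have "\<forall>l\<in>\<Lambda>. finite (G l)" using G(1) assms(1) by (meson finite_subset)
  ultimately have le: "(\<Sum>l\<in>\<Lambda>. card (G l)) \<le> card (near_pairs k U) * card (near_pairs k V)"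
    using assms(3) by (simp add: card_cartesian_product)
  have "card \<Lambda> * k = (\<Sum>l\<in>\<Lambda>. k)" by simp
  also have "\<dots> \<le> (\<Sum>l\<in>\<Lambda>. 2 * card (G l))"
    using G(2) rich by (intro sum_mono) (meson order_trans)
  also have "\<dots> \<le> 2 * (card (near_pairs k U) * card (near_pairs k V))"
    using le by (simp add: sum_distrib_left[symmetric])
  finally have "card \<Lambda> * k * k\<^sup>2 \<le> 2 * (card (near_pairs k U) * card (near_pairs k V)) * k\<^sup>2"
    by (rule mult_le_mono1)
  also have "\<dots> = 2 * ((k * card (near_pairs k U)) * (k * card (near_pairs k V)))"
    by (simp add: power2_eq_square)
  also have "\<dots> \<le> 2 * ((104 * (card U)\<^sup>2) * (104 * (card V)\<^sup>2))"
    using assms by (intro mult_le_mono order_refl card_near_pairs_le)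
  finally show ?thesis by (simp add: power3_eq_cube power2_eq_square mult.assoc)
qed

section \<open>Counting tools\<close>

lemma power_le_sum_powers:
  fixes m k :: nat
  shows "m ^ Suc k \<le> (\<Sum>t=1..m. Suc k * t ^ k)"
proof (induction m)
  case (Suc m)
  have "Suc m ^ Suc k \<le> m ^ Suc k + Suc k * Suc m ^ k" for k
  proof (induction k)
    case (Suc k)
    have "Suc m ^ Suc (Suc k) \<le> (m ^ Suc k + Suc k * Suc m ^ k) * Suc m"
      using mult_le_mono1[OF Suc.IH, of "Suc m"] by (simp add: mult.commute)
    also have "\<dots> = m ^ Suc (Suc k) + m ^ Suc k + Suc k * Suc m ^ Suc k"
      by (simp add: algebra_simps)
    also have "\<dots> \<le> m ^ Suc (Suc k) + Suc m ^ Suc k + Suc k * Suc m ^ Suc k"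
      using power_mono[of m "Suc m" "Suc k"] by linarith
    finally show ?case by simp
  qed simp
  from this[of k] show ?case using Suc.IH by (simp del: power_Suc mult_Suc)
qed simp

lemma finite_attains_max:
  fixes g :: "'a \<Rightarrow> real"
  assumes "finite I" "I \<noteq> {}"
  shows "\<exists>t\<in>I. \<forall>s\<in>I. g s \<le> g t"
proof -
  have "Max (g ` I) \<in> g ` I" using assms by (intro Max_in) auto
  then obtain t where "t \<in> I" "g t = Max (g ` I)" by auto
  then show ?thesis using assms by (intro bexI[of _ t]) auto
qed

lemma power_sum_le_level_set:
  fixes f :: "'a \<Rightarrow> nat"
  assumes "finite S" "1 \<le> N" "\<And>x. x \<in> S \<Longrightarrow> f x \<le> N"
  obtains t where "t \<in> {1..N}"
    "real (\<Sum>x\<in>S. f x ^ Suc k) \<le> Suc k * harm N * (real t ^ Suc k * real (card {x \<in> S. t \<le> f x}))"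
proof -
  define g where "g t = real t ^ Suc k * real (card {x \<in> S. t \<le> f x})" for t
  obtain t where t: "t \<in> {1..N}" "\<And>s. s \<in> {1..N} \<Longrightarrow> g s \<le> g t"
    using finite_attains_max[of "{1..N}" g] assms(2) by auto
  have "(\<Sum>x\<in>S. f x ^ Suc k) \<le> (\<Sum>x\<in>S. \<Sum>s=1..f x. Suc k * s ^ k)"
    by (intro sum_mono power_le_sum_powers)
  also have "\<dots> = (\<Sum>x\<in>S. \<Sum>s | s \<in> {1..N} \<and> s \<le> f x. Suc k * s ^ k)"
    using assms(3) by (intro sum.cong refl) (auto intro: le_trans)
  also have "\<dots> = (\<Sum>s\<in>{1..N}. \<Sum>x | x \<in> S \<and> s \<le> f x. Suc k * s ^ k)"
    using assms(1) by (intro sum.swap_restrict) auto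
  also have "\<dots> = (\<Sum>s\<in>{1..N}. Suc k * s ^ k * card {x \<in> S. s \<le> f x})"
    by (simp add: mult.commute)
  finally have "real (\<Sum>x\<in>S. f x ^ Suc k) \<le> real (\<Sum>s\<in>{1..N}. Suc k * s ^ k * card {x \<in> S. s \<le> f x})"
    by (simp only: of_nat_le_iff)
  also have "\<dots> = (\<Sum>s\<in>{1..N}. Suc k * (inverse (real s) * g s))"
    unfolding of_nat_sum by (intro sum.cong refl) (auto simp: g_def field_simps)
  also have "\<dots> \<le> (\<Sum>s\<in>{1..N}. Suc k * (inverse (real s) * g t))"
    using t(2) by (intro sum_mono mult_left_mono) auto
  also have "\<dots> = Suc k * harm N * g t"
    by (simp add: harm_def sum_distrib_left sum_distrib_right mult.assoc)
  finally show ?thesis using that t(1) by (simp add: g_def)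
qed

lemma product_sum_le_level_set:
  fixes f g :: "'a \<Rightarrow> nat"
  assumes "finite S" "1 \<le> N" "\<And>x. x \<in> S \<Longrightarrow> f x \<le> N" "\<And>x. x \<in> S \<Longrightarrow> g x \<le> N"
  obtains s t where "s \<in> {1..N}" "t \<in> {1..N}"
    "real (\<Sum>x\<in>S. f x * g x) \<le> (harm N)\<^sup>2 * (real s * real t * real (card {x \<in> S. s \<le> f x \<and> t \<le> g x}))"
proof -
  define h where "h = (\<lambda>(s, t). real s * real t * real (card {x \<in> S. s \<le> f x \<and> t \<le> g x}))"
  let ?I = "{1..N} \<times> {1..N}"
  obtain p where p: "p \<in> ?I" "\<And>q. q \<in> ?I \<Longrightarrow> h q \<le> h p"
    using finite_attains_max[of ?I h] assms(2) by force
  have "(\<Sum>x\<in>S. f x * g x) = (\<Sum>x\<in>S. \<Sum>q | q \<in> ?I \<and> (fst q \<le> f x \<and> snd q \<le> g x). 1)"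
  proof (rule sum.cong[OF refl])
    fix x assume x: "x \<in> S"
    have "{q. q \<in> ?I \<and> (fst q \<le> f x \<and> snd q \<le> g x)} = {1..f x} \<times> {1..g x}"
      using assms(3,4)[OF x] by auto
    then show "f x * g x = (\<Sum>q | q \<in> ?I \<and> (fst q \<le> f x \<and> snd q \<le> g x). 1)"
      by (simp add: card_cartesian_product)
  qed
  also have "\<dots> = (\<Sum>q\<in>?I. \<Sum>x | x \<in> S \<and> (fst q \<le> f x \<and> snd q \<le> g x). 1)"
    using assms(1) by (intro sum.swap_restrict) auto
  finally have "real (\<Sum>x\<in>S. f x * g x) = (\<Sum>q\<in>?I. real (card {x \<in> S. fst q \<le> f x \<and> snd q \<le> g x}))"
    by simp
  also have "\<dots> = (\<Sum>q\<in>?I. inverse (real (fst q)) * inverse (real (snd q)) * h q)"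
    by (intro sum.cong refl) (auto simp: h_def field_simps)
  also have "\<dots> \<le> (\<Sum>q\<in>?I. inverse (real (fst q)) * inverse (real (snd q)) * h p)"
    using p(2) by (intro sum_mono mult_left_mono) auto
  also have "\<dots> = (\<Sum>q\<in>?I. inverse (real (fst q)) * inverse (real (snd q))) * h p"
    by (simp add: sum_distrib_right)
  also have "(\<Sum>q\<in>?I. inverse (real (fst q)) * inverse (real (snd q))) = (harm N)\<^sup>2"
    by (simp add: harm_def power2_eq_square sum_product sum.cartesian_product case_prod_beta)
  finally show ?thesis using that[of "fst p" "snd p"] p(1) by (auto simp: h_def)
qed

lemma card_eq_fibre_pairs:
  assumes "finite T"
  shows "card {(t, t'). t \<in> T \<and> t' \<in> T \<and> f t = f t'} = (\<Sum>y\<in>f ` T. (card {t \<in> T. f t = y})\<^sup>2)"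
proof -
  have "{(t, t'). t \<in> T \<and> t' \<in> T \<and> f t = f t'} = (\<Union>y\<in>f ` T. {t \<in> T. f t = y} \<times> {t \<in> T. f t = y})"
    by auto
  then have "card {(t, t'). t \<in> T \<and> t' \<in> T \<and> f t = f t'} = (\<Sum>y\<in>f ` T. card ({t \<in> T. f t = y} \<times> {t \<in> T. f t = y}))"
    using assms by (simp only:, intro card_UN_disjoint) auto
  then show ?thesis by (simp add: card_cartesian_product power2_eq_square)
qed

lemma card_squared_le_fibre_pairs:
  assumes "finite T"
  shows "(card T)\<^sup>2 \<le> card (f ` T) * card {(t, t'). t \<in> T \<and> t' \<in> T \<and> f t = f t'}"
proof -
  have "card T = (\<Sum>y\<in>f ` T. card {t \<in> T. f t = y})"
  proof -
    have "card (\<Union>y\<in>f ` T. {t \<in> T. f t = y}) = (\<Sum>y\<in>f ` T. card {t \<in> T. f t = y})"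
      using assms by (intro card_UN_disjoint) auto
    moreover have "(\<Union>y\<in>f ` T. {t \<in> T. f t = y}) = T" by auto
    ultimately show ?thesis by simp
  qed
  then have "(real (card T))\<^sup>2 = (\<Sum>y\<in>f ` T. real (card {t \<in> T. f t = y}))\<^sup>2" by simp
  also have "\<dots> \<le> (\<Sum>y\<in>f ` T. (real (card {t \<in> T. f t = y}))\<^sup>2) * card (f ` T)"
    by (rule sum_squared_le_sum_of_squares)
  also have "\<dots> = real (card (f ` T) * card {(t, t'). t \<in> T \<and> t' \<in> T \<and> f t = f t'})"
    unfolding card_eq_fibre_pairs[OF assms] by simp
  finally show ?thesis by (simp only: of_nat_le_iff flip: of_nat_power)
qed

lemma rich_le_card: "finite U \<Longrightarrow> rich U V l \<le> card U"
  unfolding rich_def by (intro card_mono) auto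

lemma sum_rich_le_slopes:
  assumes "finite U" "finite V" "finite S" "finite \<Lambda>" "fst ` \<Lambda> \<subseteq> S"
  shows "(\<Sum>l\<in>\<Lambda>. rich U V l) \<le> card S * card U * card V"
proof -
  define P where "P l = {x \<in> U. fst l * x + snd l \<in> V}" for l
  have "(\<Sum>l\<in>\<Lambda>. rich U V l) = card (Sigma \<Lambda> P)"
    using assms by (simp add: rich_def P_def)
  also have "\<dots> \<le> card (S \<times> U \<times> V)"
    using assms
    by (intro card_inj_on_le[where f = "\<lambda>(l, x). (fst l, x, fst l * x + snd l)"])
       (auto simp: inj_on_def P_def)
  finally show ?thesis by (simp add: card_cartesian_product)
qed

lemma card_rich_lines_le_slopes:
  assumes "finite U" "finite V" "finite S" "finite \<Lambda>" "fst ` \<Lambda> \<subseteq> S"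
    and "\<And>l. l \<in> \<Lambda> \<Longrightarrow> k \<le> rich U V l"
  shows "card \<Lambda> * k \<le> card S * card U * card V"
proof -
  have "card \<Lambda> * k \<le> (\<Sum>l\<in>\<Lambda>. rich U V l)"
    using sum_mono[of \<Lambda> "\<lambda>_. k" "rich U V"] assms(6) by simp
  then show ?thesis using sum_rich_le_slopes[OF assms(1-5)] by linarith
qed

section \<open>Popular differences\<close>

definition rep :: "complex set \<Rightarrow> complex \<Rightarrow> nat" where
  "rep A w = card {b \<in> A. b + w \<in> A}"

definition mult_rep :: "complex set \<Rightarrow> complex \<Rightarrow> nat" where
  "mult_rep B q = card {a \<in> B. q * a \<in> B}"

definition slopes :: "complex set \<Rightarrow> complex set" where
  "slopes B = (\<lambda>(a, b). b / a) ` (B \<times> B)"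

lemma sum_mult_rep_le:
  assumes "finite B" "finite S" "0 \<notin> B"
  shows "(\<Sum>q\<in>S. mult_rep B q) \<le> (card B)\<^sup>2"
proof -
  define P where "P q = {a \<in> B. q * a \<in> B}" for q
  have "(\<Sum>q\<in>S. mult_rep B q) = card (Sigma S P)"
    using assms by (simp add: mult_rep_def P_def)
  also have "\<dots> \<le> card (B \<times> B)"
    using assms
    by (intro card_inj_on_le[where f = "\<lambda>(q, a). (a, q * a)"]) (auto simp: inj_on_def P_def)
  finally show ?thesis by (simp add: card_cartesian_product power2_eq_square)
qed

lemma lines_through_popular_differences:
  assumes fin: "finite A" "finite W" "finite S"
    and B: "B \<subseteq> A" "\<And>a. a \<in> B \<Longrightarrow> h \<le> card {b \<in> A. a - b \<in> W}"
    and S: "\<And>q. q \<in> S \<Longrightarrow> N \<le> mult_rep B q"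
  defines "\<Lambda> \<equiv> Sigma S (\<lambda>q. (\<lambda>(b, b'). q * b - b') ` (A \<times> A))"
  shows "card S * (N * h\<^sup>2) \<le> (\<Sum>l\<in>\<Lambda>. rich A A (fst l, - snd l) * rich W W l)"
proof -
  define J where "J q = (\<lambda>(b, b'). q * b - b') ` (A \<times> A)" for q
  define D where "D a = {b \<in> A. a - b \<in> W}" for a
  have finB: "finite B" using B(1) fin(1) finite_subset by blast
  have finD: "finite (D a)" for a using fin by (simp add: D_def)
  have *: "N * h\<^sup>2 \<le> (\<Sum>j\<in>J q. rich A A (q, - j) * rich W W (q, j))" if "q \<in> S" for q
  proof -
    define P where "P = {a \<in> B. q * a \<in> B}"
    define X where "X = Sigma P (\<lambda>a. D a \<times> D (q * a))"
    define Y where "Y = Sigma (J q) (\<lambda>j. {x \<in> A. q * x + - j \<in> A} \<times> {x \<in> W. q * x + j \<in> W})"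
    have "N * h\<^sup>2 \<le> card P * h\<^sup>2" using S[OF that] by (simp add: mult_rep_def P_def)
    also have "\<dots> = (\<Sum>a\<in>P. h * h)" by (simp add: power2_eq_square)
    also have "\<dots> \<le> (\<Sum>a\<in>P. card (D a) * card (D (q * a)))"
      using B(2) by (intro sum_mono mult_le_mono) (auto simp: P_def D_def)
    also have "\<dots> = card X"
      using finB finD by (simp add: X_def P_def card_cartesian_product)
    also have "\<dots> \<le> card Y"
    proof (rule card_inj_on_le[where f = "\<lambda>(a, b, b'). (q * b - b', b, a - b)"])
      show "inj_on (\<lambda>(a, b, b'). (q * b - b', b, a - b)) X" by (auto simp: inj_on_def)
      show "(\<lambda>(a, b, b'). (q * b - b', b, a - b)) ` X \<subseteq> Y"
        by (auto simp: X_def Y_def P_def D_def J_def algebra_simps)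
      show "finite Y" using fin by (auto simp: Y_def J_def)
    qed
    also have "\<dots> = (\<Sum>j\<in>J q. rich A A (q, - j) * rich W W (q, j))"
      using fin by (simp add: Y_def J_def rich_def card_cartesian_product)
    finally show ?thesis .
  qed
  have "card S * (N * h\<^sup>2) = (\<Sum>q\<in>S. N * h\<^sup>2)" by simp
  also have "\<dots> \<le> (\<Sum>q\<in>S. \<Sum>j\<in>J q. rich A A (q, - j) * rich W W (q, j))"
    by (intro sum_mono *)
  also have "\<dots> = (\<Sum>l\<in>\<Lambda>. rich A A (fst l, - snd l) * rich W W l)"
    unfolding \<Lambda>_def J_def using fin by (subst sum.Sigma) (auto simp: case_prod_beta)
  finally show ?thesis .
qed

text \<open>With \<open>lam\<close> lines that are \<open>mu\<close>-rich in \<open>A \<times> A\<close> and \<open>ka\<close>-rich in \<open>W \<times> W\<close>, the incidence bound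
  needs richness at least 2.  It is available for \<open>W \<times> W\<close> in the first of the next two lemmas only;
  in the second one \<open>ka = 1\<close>.\<close>

lemma popular_bound_arith_rich:
  fixes L N h w \<tau> n p H b lam mu ka :: real
  assumes nn: "0 \<le> N" "0 \<le> h" "0 \<le> \<tau>" "0 \<le> n" "0 \<le> p" "0 \<le> H" "0 \<le> b" "0 \<le> lam" "0 \<le> mu" "0 \<le> ka"
    and pos: "0 < L" "0 < w"
    and a: "w * \<tau> \<le> H * h * b" and b: "b ^ 4 \<le> p * (2 * H * (N\<^sup>2 * L))"
    and c: "L * (N * h\<^sup>2) \<le> H\<^sup>2 * (mu * ka * lam)"
    and d: "lam * mu ^ 3 \<le> C * n ^ 4" and e: "lam * mu \<le> L * n\<^sup>2"
    and f: "lam * ka ^ 3 \<le> C * w ^ 4" and C: "0 \<le> C"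
  shows "w ^ 4 * \<tau> ^ 12 \<le> 8 * C ^ 3 * H ^ 27 * p ^ 3 * n ^ 10"
proof -
  have "(mu * ka * lam) ^ 6 = (lam * ka ^ 3)\<^sup>2 * ((lam * mu ^ 3) * (lam * mu) ^ 3)"
    by (simp add: power_mult_distrib power2_eq_square power3_eq_cube power_numeral_reduce algebra_simps)
  also have "\<dots> \<le> (C * w ^ 4)\<^sup>2 * ((C * n ^ 4) * (L * n\<^sup>2) ^ 3)"
    using nn pos C by (intro mult_mono[OF power_mono[OF f]] mult_mono[OF d] power_mono[OF e]) auto
  finally have 1: "(mu * ka * lam) ^ 6 \<le> (C * w ^ 4)\<^sup>2 * ((C * n ^ 4) * (L * n\<^sup>2) ^ 3)" .
  have "L ^ 3 * (L ^ 3 * (N ^ 6 * h ^ 12)) = (L * (N * h\<^sup>2)) ^ 6"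
    by (simp add: power_mult_distrib flip: power_mult power_add mult.assoc)
  also have "\<dots> \<le> (H\<^sup>2 * (mu * ka * lam)) ^ 6"
    using nn pos c by (intro power_mono) auto
  also have "\<dots> = H ^ 12 * (mu * ka * lam) ^ 6"
    by (simp add: power_mult_distrib flip: power_mult)
  also have "\<dots> \<le> H ^ 12 * ((C * w ^ 4)\<^sup>2 * ((C * n ^ 4) * (L * n\<^sup>2) ^ 3))"
    using 1 nn by (intro mult_left_mono) auto
  also have "\<dots> = L ^ 3 * (C ^ 3 * H ^ 12 * w ^ 8 * n ^ 10)"
    by (simp add: power_mult_distrib power2_eq_square power3_eq_cube power_numeral_reduce algebra_simps)
  finally have 2: "L ^ 3 * (N ^ 6 * h ^ 12) \<le> C ^ 3 * H ^ 12 * w ^ 8 * n ^ 10"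
    by (rule mult_left_le_imp_le) (use pos in simp)
  have 3: "b ^ 12 \<le> (p * (2 * H * (N\<^sup>2 * L))) ^ 3"
    using power_mono[OF b, of 3] by (simp flip: power_mult)
  have "w ^ 8 * (w ^ 4 * \<tau> ^ 12) = (w * \<tau>) ^ 12"
    by (simp add: power_mult_distrib flip: power_add mult.assoc)
  also have "\<dots> \<le> (H * h * b) ^ 12" using nn pos a by (intro power_mono) auto
  also have "\<dots> = H ^ 12 * h ^ 12 * b ^ 12" by (simp add: power_mult_distrib)
  also have "\<dots> \<le> H ^ 12 * h ^ 12 * (p * (2 * H * (N\<^sup>2 * L))) ^ 3"
    using 3 nn by (intro mult_left_mono) auto
  also have "\<dots> = 8 * H ^ 15 * p ^ 3 * (L ^ 3 * (N ^ 6 * h ^ 12))"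
    by (simp add: power_mult_distrib power2_eq_square power3_eq_cube power_numeral_reduce algebra_simps)
  also have "\<dots> \<le> 8 * H ^ 15 * p ^ 3 * (C ^ 3 * H ^ 12 * w ^ 8 * n ^ 10)"
    using 2 nn by (intro mult_left_mono) auto
  also have "\<dots> = w ^ 8 * (8 * C ^ 3 * H ^ 27 * p ^ 3 * n ^ 10)"
    by (simp add: power_add[symmetric] algebra_simps)
  finally show ?thesis by (rule mult_left_le_imp_le) (use pos in simp)
qed

lemma popular_bound_arith_poor:
  fixes L N h w \<tau> n p H b lam mu :: real
  assumes nn: "0 \<le> N" "0 \<le> h" "0 \<le> \<tau>" "0 \<le> n" "0 \<le> p" "0 \<le> H" "0 \<le> lam" "0 \<le> mu"
    and pos: "0 < L" "0 < w" "0 < b"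
    and a: "w * \<tau> \<le> H * h * b" and b: "b ^ 4 \<le> p * (2 * H * (N\<^sup>2 * L))"
    and c: "L * (N * h\<^sup>2) \<le> H\<^sup>2 * (mu * lam)"
    and d: "lam * mu ^ 3 \<le> C * n ^ 4" and e: "lam \<le> L * w\<^sup>2"
    and f: "L * N \<le> b\<^sup>2" and g: "p \<le> n\<^sup>2" and C: "0 \<le> C"
  shows "w ^ 4 * \<tau> ^ 12 \<le> 16 * C\<^sup>2 * H ^ 28 * p ^ 3 * n ^ 10"
proof -
  have "L\<^sup>2 * (L * (N ^ 3 * h ^ 6)) = (L * (N * h\<^sup>2)) ^ 3"
    by (simp add: power_mult_distrib power3_eq_cube power2_eq_square flip: power_mult)
       (simp add: power_numeral_reduce)
  also have "\<dots> \<le> (H\<^sup>2 * (mu * lam)) ^ 3"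
    using nn pos c by (intro power_mono) auto
  also have "\<dots> = H ^ 6 * ((lam * mu ^ 3) * lam\<^sup>2)"
    by (simp add: power_mult_distrib power2_eq_square power3_eq_cube power_numeral_reduce algebra_simps)
  also have "\<dots> \<le> H ^ 6 * ((C * n ^ 4) * (L * w\<^sup>2)\<^sup>2)"
    using nn pos C by (intro mult_left_mono mult_mono[OF d] power_mono[OF e]) auto
  also have "\<dots> = L\<^sup>2 * (C * H ^ 6 * n ^ 4 * w ^ 4)"
    by (simp add: power_mult_distrib power2_eq_square power_numeral_reduce algebra_simps)
  finally have 2: "L * (N ^ 3 * h ^ 6) \<le> C * H ^ 6 * n ^ 4 * w ^ 4"
    by (rule mult_left_le_imp_le) (use pos in simp)
  have "b\<^sup>2 * b\<^sup>2 \<le> (2 * p * H * N) * (L * N)"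
    using b by (simp add: power2_eq_square power_numeral_reduce algebra_simps)
  also have "\<dots> \<le> (2 * p * H * N) * b\<^sup>2"
    using f nn by (intro mult_left_mono) auto
  finally have 3: "b\<^sup>2 \<le> 2 * p * H * N" by (rule mult_right_le_imp_le) (use pos in simp)
  have "w ^ 4 * (w\<^sup>2 * \<tau> ^ 6) = (w * \<tau>) ^ 6"
    by (simp add: power_mult_distrib flip: power_add mult.assoc)
  also have "\<dots> \<le> (H * h * b) ^ 6" using nn pos a by (intro power_mono) auto
  also have "\<dots> = H ^ 6 * h ^ 6 * (b ^ 4 * b\<^sup>2)" by (simp add: power_mult_distrib flip: power_add)
  also have "\<dots> \<le> H ^ 6 * h ^ 6 * ((p * (2 * H * (N\<^sup>2 * L))) * (2 * p * H * N))"
    using b 3 nn pos by (intro mult_left_mono mult_mono) auto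
  also have "\<dots> = 4 * H ^ 8 * p\<^sup>2 * (L * (N ^ 3 * h ^ 6))"
    by (simp add: power2_eq_square power3_eq_cube power_numeral_reduce algebra_simps)
  also have "\<dots> \<le> 4 * H ^ 8 * p\<^sup>2 * (C * H ^ 6 * n ^ 4 * w ^ 4)"
    using 2 nn by (intro mult_left_mono) auto
  also have "\<dots> = w ^ 4 * (4 * C * H ^ 14 * p\<^sup>2 * n ^ 4)"
    by (simp add: power_add[symmetric] algebra_simps)
  finally have 4: "w\<^sup>2 * \<tau> ^ 6 \<le> 4 * C * H ^ 14 * p\<^sup>2 * n ^ 4"
    by (rule mult_left_le_imp_le) (use pos in simp)
  have "w ^ 4 * \<tau> ^ 12 = (w\<^sup>2 * \<tau> ^ 6)\<^sup>2"
    by (simp add: power_mult_distrib flip: power_mult)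
  also have "\<dots> \<le> (4 * C * H ^ 14 * p\<^sup>2 * n ^ 4)\<^sup>2"
    using 4 nn pos by (intro power_mono) auto
  also have "\<dots> = 16 * C\<^sup>2 * H ^ 28 * p ^ 3 * n ^ 8 * p"
    by (simp add: power_mult_distrib power2_eq_square power3_eq_cube flip: power_mult)
       (simp add: power_add[symmetric] power_numeral_reduce)
  also have "\<dots> \<le> 16 * C\<^sup>2 * H ^ 28 * p ^ 3 * n ^ 8 * n\<^sup>2"
    using g nn C by (intro mult_left_mono) auto
  also have "\<dots> = 16 * C\<^sup>2 * H ^ 28 * p ^ 3 * n ^ 10"
    by (simp add: power_add[symmetric] mult.assoc)
  finally show ?thesis .
qed

lemma harm_ge_one: "1 \<le> n \<Longrightarrow> (1::real) \<le> harm n"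
  using harm_mono[of 1 n, where 'a = real] by (simp add: harm_expand)

theorem card_popular_differences_le:
  fixes p :: real
  assumes fin: "finite A" "finite W" and A: "0 \<notin> A" "A \<noteq> {}"
    and W: "\<And>w. w \<in> W \<Longrightarrow> \<tau> \<le> rep A w" "card W \<le> (card A)\<^sup>2"
    and p: "0 \<le> p" "p \<le> (real (card A))\<^sup>2"
    and energy: "\<And>B. B \<subseteq> A \<Longrightarrow> real (card B) ^ 4 \<le> p * real (\<Sum>q\<in>slopes B. (mult_rep B q)\<^sup>2)"
  shows "real (card W) ^ 4 * real \<tau> ^ 12
    \<le> 8 * 21632 ^ 3 * harm ((card A)\<^sup>2) ^ 28 * p ^ 3 * real (card A) ^ 10"
proof (cases "W = {} \<or> \<tau> = 0")
  case True
  then show ?thesis using p by (auto intro!: mult_nonneg_nonneg simp: harm_nonneg)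
next
  case False
  define n where "n = card A"
  define H :: real where "H = harm (n\<^sup>2)"
  have n1: "1 \<le> n" using fin A by (simp add: n_def Suc_le_eq card_gt_0_iff)
  then have nn2: "n \<le> n\<^sup>2" "1 \<le> n\<^sup>2" by (simp_all add: power2_eq_square)
  have H1: "1 \<le> H" using harm_ge_one[OF nn2(2)] by (simp add: H_def)
  have Hn: "harm n \<le> H" using harm_mono[OF nn2(1)] by (simp add: H_def)
  have w1: "card W > 0" "\<tau> > 0" using False fin by (auto simp: card_gt_0_iff)
  define f where "f a = card {b \<in> A. a - b \<in> W}" for a
  have fle: "f a \<le> n" for a unfolding f_def n_def using fin by (intro card_mono) auto
  have "card W * \<tau> = (\<Sum>w\<in>W. \<tau>)" by simp
  also have "\<dots> \<le> (\<Sum>w\<in>W. rep A w)" using W by (intro sum_mono)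
  also have "\<dots> = card (Sigma W (\<lambda>w. {b \<in> A. b + w \<in> A}))" using fin by (simp add: rep_def)
  also have "\<dots> \<le> card (Sigma A (\<lambda>a. {b \<in> A. a - b \<in> W}))"
    using fin by (intro card_inj_on_le[where f = "\<lambda>(w, b). (b + w, b)"]) (auto simp: inj_on_def)
  also have "\<dots> = (\<Sum>a\<in>A. f a)" using fin by (simp add: f_def)
  finally have sumf: "card W * \<tau> \<le> (\<Sum>a\<in>A. f a ^ Suc 0)" by simp
  obtain h where h: "h \<in> {1..n}"
    "real (\<Sum>a\<in>A. f a ^ Suc 0) \<le> Suc 0 * harm n * (real h ^ Suc 0 * real (card {a \<in> A. h \<le> f a}))"
    by (rule power_sum_le_level_set[OF fin(1) n1 fle, where k = 0])
  define B where "B = {a \<in> A. h \<le> f a}"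
  have BA: "B \<subseteq> A" "finite B" "0 \<notin> B" using fin A by (auto simp: B_def)
  have a: "real (card W) * real \<tau> \<le> H * real h * real (card B)"
  proof -
    have "real (card W) * real \<tau> \<le> harm n * (real h * real (card B))"
      using sumf h(2) unfolding B_def by (simp add: order_trans flip: of_nat_mult of_nat_sum)
    also have "\<dots> \<le> H * (real h * real (card B))" using Hn by (intro mult_right_mono) auto
    finally show ?thesis by (simp add: mult.assoc)
  qed
  have Bpos: "card B > 0"
  proof (rule ccontr)
    assume "\<not> ?thesis"
    then have "real (card W) * real \<tau> \<le> 0" using a by simp
    then show False using w1 by (simp add: mult_le_0_iff)
  qed
  have Bn: "card B \<le> n" using BA fin by (simp add: n_def card_mono)
  have finS: "finite (slopes B)" using BA by (simp add: slopes_def)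
  have mle: "mult_rep B q \<le> n" for q
    unfolding mult_rep_def using BA Bn card_mono[of B "{a \<in> B. q * a \<in> B}"] by force
  obtain N where N: "N \<in> {1..n}"
    "real (\<Sum>q\<in>slopes B. mult_rep B q ^ Suc 1)
      \<le> Suc 1 * harm n * (real N ^ Suc 1 * real (card {q \<in> slopes B. N \<le> mult_rep B q}))"
    by (rule power_sum_le_level_set[OF finS n1 mle, where k = 1])
  define S where "S = {q \<in> slopes B. N \<le> mult_rep B q}"
  have S: "finite S" "0 \<notin> S" "S \<subseteq> slopes B" using finS BA by (auto simp: S_def slopes_def)
  have b: "real (card B) ^ 4 \<le> p * (2 * H * ((real N)\<^sup>2 * real (card S)))"
  proof -
    have "real (card B) ^ 4 \<le> p * (2 * harm n * ((real N)\<^sup>2 * real (card S)))"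
      using energy[OF BA(1)] mult_left_mono[OF N(2) p(1)] unfolding S_def
      by (simp add: numeral_2_eq_2)
    also have "\<dots> \<le> p * (2 * H * ((real N)\<^sup>2 * real (card S)))"
      using Hn p by (intro mult_left_mono mult_right_mono) auto
    finally show ?thesis .
  qed
  have Spos: "card S > 0"
  proof (rule ccontr)
    assume "\<not> ?thesis"
    then have "real (card B) ^ 4 \<le> 0" using b by simp
    then show False using Bpos by simp
  qed
  have LN: "card S * N \<le> (card B)\<^sup>2"
  proof -
    have "card S * N \<le> (\<Sum>q\<in>S. mult_rep B q)"
      using sum_mono[of S "\<lambda>_. N" "mult_rep B"] by (simp add: S_def)
    then show ?thesis using sum_mult_rep_le[of B S] BA S by linarith
  qed
  have Sle: "card S \<le> n\<^sup>2"
  proof -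
    have "card S \<le> card (slopes B)" using S finS by (intro card_mono)
    also have "\<dots> \<le> card (B \<times> B)" unfolding slopes_def using BA by (intro card_image_le) auto
    also have "\<dots> \<le> n\<^sup>2" using Bn by (simp add: card_cartesian_product power2_eq_square mult_le_mono)
    finally show ?thesis .
  qed
  define \<Lambda> where "\<Lambda> = Sigma S (\<lambda>q. (\<lambda>(b, b'). q * b - b') ` (A \<times> A))"
  have fin\<Lambda>: "finite \<Lambda>" using S fin by (auto simp: \<Lambda>_def)
  have sum\<Lambda>: "card S * (N * h\<^sup>2) \<le> (\<Sum>l\<in>\<Lambda>. rich A A (fst l, - snd l) * rich W W l)"
    unfolding \<Lambda>_def
    by (rule lines_through_popular_differences[of A W S B h N]) (use fin S BA in \<open>auto simp: B_def f_def S_def\<close>)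
  have r1: "rich A A (fst l, - snd l) \<le> n\<^sup>2" for l
    using rich_le_card[OF fin(1), of A "(fst l, - snd l)"] nn2 n_def by linarith
  have r2: "rich W W l \<le> n\<^sup>2" for l
    using rich_le_card[OF fin(2), of W l] W(2) by (simp add: n_def)
  obtain mu ka where mk: "mu \<in> {1..n\<^sup>2}" "ka \<in> {1..n\<^sup>2}"
    "real (\<Sum>l\<in>\<Lambda>. rich A A (fst l, - snd l) * rich W W l) \<le>
      H\<^sup>2 * (real mu * real ka * real (card {l \<in> \<Lambda>. mu \<le> rich A A (fst l, - snd l) \<and> ka \<le> rich W W l}))"
    by (rule product_sum_le_level_set[OF fin\<Lambda> nn2(2) r1 r2, folded H_def])
  define M where "M = {l \<in> \<Lambda>. mu \<le> rich A A (fst l, - snd l) \<and> ka \<le> rich W W l}"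
  have M: "finite M" "fst ` M \<subseteq> S" using fin\<Lambda> by (auto simp: M_def \<Lambda>_def)
  have c: "real (card S) * (real N * (real h)\<^sup>2) \<le> H\<^sup>2 * (real mu * real ka * real (card M))"
  proof -
    have "real (card S) * (real N * (real h)\<^sup>2) = real (card S * (N * h\<^sup>2))" by simp
    also have "\<dots> \<le> real (\<Sum>l\<in>\<Lambda>. rich A A (fst l, - snd l) * rich W W l)" using sum\<Lambda> by (simp only: of_nat_le_iff)
    finally show ?thesis using mk(3) unfolding M_def by linarith
  qed
  define M' where "M' = (\<lambda>l. (fst l, - snd l)) ` M"
  have "inj_on (\<lambda>l::complex \<times> complex. (fst l, - snd l)) M" by (auto simp: inj_on_def prod_eq_iff)
  then have M': "card M' = card M" "finite M'" "fst ` M' \<subseteq> S" "\<And>l. l \<in> M' \<Longrightarrow> mu \<le> rich A A l"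
    using M by (auto simp: M'_def card_image) (auto simp: M_def)
  have e: "card M * mu \<le> card S * n\<^sup>2"
    using card_rich_lines_le_slopes[OF fin(1,1) S(1) M'(2-4)] M'(1)
    by (simp add: n_def power2_eq_square mult.assoc)
  have d: "card M * mu ^ 3 \<le> 21632 * n ^ 4"
  proof (cases "mu \<ge> 2")
    case True
    have "card M' * mu ^ 3 \<le> 21632 * (card A)\<^sup>2 * (card A)\<^sup>2"
      using True M' S fin by (intro card_rich_lines_le) auto
    then show ?thesis by (simp add: M'(1) n_def power2_eq_square power4_eq_xxxx mult.assoc)
  next
    case False
    then have "mu = 1" using mk(1) by simp
    then have "card M * mu ^ 3 \<le> card S * n\<^sup>2" using e by simp
    also have "\<dots> \<le> n\<^sup>2 * n\<^sup>2" using Sle by (rule mult_le_mono1)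
    also have "\<dots> = n ^ 4" by (simp flip: power_add)
    finally show ?thesis by linarith
  qed
  have reals: "real (card M) * real mu ^ 3 \<le> 21632 * real n ^ 4" "real (card M) * real mu \<le> real (card S) * (real n)\<^sup>2"
    "real (card S) * real N \<le> (real (card B))\<^sup>2"
    using d e LN by (metis of_nat_le_iff of_nat_mult of_nat_numeral of_nat_power)+
  have "real (card W) ^ 4 * real \<tau> ^ 12 \<le> 8 * 21632 ^ 3 * H ^ 28 * p ^ 3 * real n ^ 10"
  proof (cases "ka \<ge> 2")
    case True
    have "card M * ka ^ 3 \<le> 21632 * (card W)\<^sup>2 * (card W)\<^sup>2"
      using True M S fin by (intro card_rich_lines_le) (auto simp: M_def)
    then have "card M * ka ^ 3 \<le> 21632 * card W ^ 4"
      by (simp add: power2_eq_square power4_eq_xxxx mult.assoc)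
    then have "real (card M) * real ka ^ 3 \<le> 21632 * real (card W) ^ 4"
      by (metis of_nat_le_iff of_nat_mult of_nat_numeral of_nat_power)
    then have "real (card W) ^ 4 * real \<tau> ^ 12 \<le> 8 * 21632 ^ 3 * H ^ 27 * p ^ 3 * real n ^ 10"
      using a b c reals Spos w1 p H1 by (intro popular_bound_arith_rich[where lam = "real (card M)"]) auto
    also have "\<dots> \<le> 8 * 21632 ^ 3 * H ^ 28 * p ^ 3 * real n ^ 10"
      using H1 p by (intro mult_right_mono mult_left_mono power_increasing) auto
    finally show ?thesis .
  next
    case False
    then have ka: "ka = 1" using mk(2) by simp
    have "card M * 1 \<le> card S * card W * card W"
      using M S fin ka by (intro card_rich_lines_le_slopes) (auto simp: M_def)
    then have "real (card M) \<le> real (card S) * (real (card W))\<^sup>2"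
      by (simp add: power2_eq_square mult.assoc) (metis of_nat_le_iff of_nat_mult)
    then have "real (card W) ^ 4 * real \<tau> ^ 12 \<le> 16 * 21632\<^sup>2 * H ^ 28 * p ^ 3 * real n ^ 10"
      using a b c ka reals Spos Bpos w1 p H1
      by (intro popular_bound_arith_poor[where lam = "real (card M)" and b = "real (card B)"]) (auto simp: n_def)
    also have "\<dots> \<le> 8 * 21632 ^ 3 * H ^ 28 * p ^ 3 * real n ^ 10"
      using H1 p by (intro mult_right_mono) auto
    finally show ?thesis .
  qed
  then show ?thesis by (simp add: H_def n_def)
qed

section \<open>The energy of a set and its difference set\<close>

definition shift_rep :: "complex set \<Rightarrow> complex set \<Rightarrow> complex \<Rightarrow> nat" where
  "shift_rep A Z x = card {t \<in> A \<times> Z. fst t - snd t = x}"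

definition energy :: "complex set \<Rightarrow> complex set \<Rightarrow> nat" where
  "energy A Z = card {(t, t'). t \<in> A \<times> Z \<and> t' \<in> A \<times> Z \<and> fst t - snd t = fst t' - snd t'}"

lemma shift_rep_le:
  assumes "finite A" "finite Z"
  shows "shift_rep A Z x \<le> card A" "shift_rep A Z x \<le> card Z"
proof -
  show "shift_rep A Z x \<le> card A"
    unfolding shift_rep_def using assms by (intro card_inj_on_le[where f = fst]) (auto simp: inj_on_def)
  show "shift_rep A Z x \<le> card Z"
    unfolding shift_rep_def using assms by (intro card_inj_on_le[where f = snd]) (auto simp: inj_on_def)
qed

lemma card_popular_shifts_le:
  assumes fin: "finite A" "finite Z" "finite U" "finite Q" "finite X"
    and zero: "0 \<notin> U" "0 \<notin> Q" and U: "U \<noteq> {}" "\<And>a u. a \<in> A \<Longrightarrow> u \<in> U \<Longrightarrow> a / u \<in> Q"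
    and X: "\<And>x. x \<in> X \<Longrightarrow> \<tau> \<le> shift_rep A Z x"
  shows "real (card U) * (real (card X) * real \<tau> ^ 3)
    \<le> 21632 * harm (card U) ^ 3 * (real (card Q) * real (card Z))\<^sup>2"
proof (cases "X = {} \<or> \<tau> = 0")
  case True
  then show ?thesis by (auto intro!: mult_nonneg_nonneg simp: harm_nonneg)
next
  case False
  define n where "n = card U"
  define H :: real where "H = harm n"
  have n1: "1 \<le> n" using fin U by (simp add: n_def Suc_le_eq card_gt_0_iff)
  have H1: "1 \<le> H" using harm_ge_one[OF n1] by (simp add: H_def)
  have Xpos: "card X > 0" using False fin by (auto simp: card_gt_0_iff)
  define \<Lambda> where "\<Lambda> = Q \<times> uminus ` Z"
  have fin\<Lambda>: "finite \<Lambda>" using fin by (simp add: \<Lambda>_def)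
  have c\<Lambda>: "card \<Lambda> = card Q * card Z"
    by (simp add: \<Lambda>_def card_cartesian_product card_image inj_on_def)
  define F where "F x = {t \<in> A \<times> Z. fst t - snd t = x}" for x
  have finF: "finite (F x)" for x using fin by (auto simp: F_def)
  have "n * (card X * \<tau>) = n * (\<Sum>x\<in>X. \<tau>)" by simp
  also have "\<dots> \<le> n * (\<Sum>x\<in>X. card (F x))"
    using X by (intro mult_left_mono sum_mono) (auto simp: shift_rep_def F_def)
  also have "\<dots> = card (U \<times> Sigma X F)" using fin finF by (simp add: n_def card_cartesian_product)
  also have "\<dots> \<le> card (Sigma \<Lambda> (\<lambda>l. {u \<in> U. fst l * u + snd l \<in> X}))"
  proof (rule card_inj_on_le[where f = "\<lambda>(u, x, t). ((fst t / u, - snd t), u)"])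
    show "inj_on (\<lambda>(u, x, t). ((fst t / u, - snd t), u)) (U \<times> Sigma X F)"
      using zero by (auto simp: inj_on_def F_def)
    show "(\<lambda>(u, x, t). ((fst t / u, - snd t), u)) ` (U \<times> Sigma X F)
        \<subseteq> Sigma \<Lambda> (\<lambda>l. {u \<in> U. fst l * u + snd l \<in> X})"
      using zero U by (auto simp: F_def \<Lambda>_def)
    show "finite (Sigma \<Lambda> (\<lambda>l. {u \<in> U. fst l * u + snd l \<in> X}))"
      using fin fin\<Lambda> by auto
  qed
  also have "\<dots> = (\<Sum>l\<in>\<Lambda>. rich U X l ^ Suc 0)" using fin fin\<Lambda> by (simp add: rich_def)
  finally have I: "n * (card X * \<tau>) \<le> (\<Sum>l\<in>\<Lambda>. rich U X l ^ Suc 0)" .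
  have rle: "rich U X l \<le> n" for l using rich_le_card[OF fin(3)] by (simp add: n_def)
  obtain k where k: "k \<in> {1..n}"
    "real (\<Sum>l\<in>\<Lambda>. rich U X l ^ Suc 0) \<le> Suc 0 * harm n * (real k ^ Suc 0 * real (card {l \<in> \<Lambda>. k \<le> rich U X l}))"
    by (rule power_sum_le_level_set[OF fin\<Lambda> n1 rle, where k = 0])
  define M where "M = {l \<in> \<Lambda>. k \<le> rich U X l}"
  have Mle: "card M \<le> card Q * card Z" using fin\<Lambda> card_mono[of \<Lambda> M] by (simp add: M_def c\<Lambda>)
  have I2: "real n * (real (card X) * real \<tau>) \<le> H * (real k * real (card M))"
  proof -
    have "real n * (real (card X) * real \<tau>) = real (n * (card X * \<tau>))" by simp
    also have "\<dots> \<le> real (\<Sum>l\<in>\<Lambda>. rich U X l ^ Suc 0)" using I by (simp only: of_nat_le_iff)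
    also have "\<dots> \<le> H * (real k * real (card M))" using k(2) by (simp add: M_def H_def)
    finally show ?thesis .
  qed
  define q d x t where "q = real (card Q)" and "d = real (card Z)" and "x = real (card X)" and "t = real \<tau>"
  have x0: "0 < x" "0 \<le> q" "0 \<le> d" "0 < real n" "0 \<le> t" using Xpos n1 by (auto simp: x_def q_def d_def t_def)
  have "real n * (x * t ^ 3) \<le> 21632 * H ^ 3 * (q * d)\<^sup>2"
  proof (cases "k \<ge> 2")
    case True
    have "card M * k ^ 3 \<le> 21632 * (card U)\<^sup>2 * (card X)\<^sup>2"
      using True fin fin\<Lambda> zero by (intro card_rich_lines_le) (auto simp: M_def \<Lambda>_def)
    then have "real (card M * k ^ 3) \<le> real (21632 * (card U)\<^sup>2 * (card X)\<^sup>2)"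
      by (simp only: of_nat_le_iff)
    then have ST: "real (card M) * real k ^ 3 \<le> 21632 * (real n)\<^sup>2 * x\<^sup>2"
      by (simp add: n_def x_def)
    have "(real n * x)\<^sup>2 * (real n * (x * t ^ 3)) = (real n * (x * t)) ^ 3"
      by (simp add: power2_eq_square power3_eq_cube)
    also have "\<dots> \<le> (H * (real k * real (card M))) ^ 3"
      using I2 x0 by (intro power_mono) (auto simp: x_def t_def)
    also have "\<dots> = H ^ 3 * ((real (card M) * real k ^ 3) * (real (card M))\<^sup>2)"
      by (simp add: power2_eq_square power3_eq_cube)
    also have "\<dots> \<le> H ^ 3 * ((21632 * (real n)\<^sup>2 * x\<^sup>2) * (q * d)\<^sup>2)"
      using H1 Mle by (intro mult_left_mono mult_mono[OF ST] power_mono)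
        (auto simp: q_def d_def simp flip: of_nat_mult)
    also have "\<dots> = (real n * x)\<^sup>2 * (21632 * H ^ 3 * (q * d)\<^sup>2)"
      by (simp add: power_mult_distrib)
    finally show ?thesis by (rule mult_left_le_imp_le) (use x0 in simp)
  next
    case False
    then have k1: "k = 1" using k(1) by simp
    have "real (card M) \<le> q * d" using Mle by (simp add: q_def d_def flip: of_nat_mult)
    then have "H * real (card M) \<le> H * (q * d)" using H1 by (intro mult_left_mono) auto
    then have 1: "real n * (x * t) \<le> H * (q * d)"
      using I2 k1 unfolding x_def t_def by simp
    obtain y where y: "y \<in> X" using False Xpos by fastforce
    have "t \<le> d" using X[OF y] shift_rep_le(2)[OF fin(1,2), of y] by (simp add: t_def d_def)
    obtain u where u: "u \<in> U" using U by auto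
    have "card A \<le> card Q"
      using zero u U fin by (intro card_inj_on_le[where f = "\<lambda>a. a / u"]) (auto simp: inj_on_def)
    then have "t \<le> q" using X[OF y] shift_rep_le(1)[OF fin(1,2), of y] by (simp add: t_def q_def)
    then have "t\<^sup>2 \<le> q * d" using \<open>t \<le> d\<close> x0 by (simp add: power2_eq_square mult_mono)
    then have "(real n * (x * t)) * t\<^sup>2 \<le> (H * (q * d)) * (q * d)"
      using x0 H1 by (intro mult_mono[OF 1]) auto
    then have "real n * (x * t ^ 3) \<le> H * (q * d)\<^sup>2"
      by (simp add: power2_eq_square power3_eq_cube algebra_simps)
    also have "\<dots> \<le> 21632 * H ^ 3 * (q * d)\<^sup>2"
      using H1 self_le_power[of H 3] by (intro mult_right_mono) auto
    finally show ?thesis .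
  qed
  then show ?thesis by (simp add: n_def H_def q_def d_def x_def t_def)
qed

theorem energy_squared_le:
  assumes fin: "finite A" "finite Z" "finite U" "finite Q"
    and zero: "0 \<notin> U" "0 \<notin> Q" and U: "A \<noteq> {}" "card U = card A" "\<And>a u. a \<in> A \<Longrightarrow> u \<in> U \<Longrightarrow> a / u \<in> Q"
  shows "(real (energy A Z))\<^sup>2 \<le> 86528 * harm (card A) ^ 5 * real (card Q) ^ 2 * real (card Z) ^ 3"
proof -
  define n where "n = card A"
  define H :: real where "H = harm n"
  define Y where "Y = (\<lambda>t. fst t - snd t) ` (A \<times> Z)"
  have n1: "1 \<le> n" using fin U by (simp add: n_def Suc_le_eq card_gt_0_iff)
  have H1: "1 \<le> H" using harm_ge_one[OF n1] by (simp add: H_def)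
  have finY: "finite Y" using fin by (simp add: Y_def)
  have E: "energy A Z = (\<Sum>x\<in>Y. shift_rep A Z x ^ Suc 1)"
    unfolding energy_def Y_def shift_rep_def using fin
    by (subst card_eq_fibre_pairs) (auto simp: numeral_2_eq_2)
  have le: "shift_rep A Z x \<le> n" for x using shift_rep_le[OF fin(1,2)] by (simp add: n_def)
  obtain t where t: "t \<in> {1..n}"
    "real (\<Sum>x\<in>Y. shift_rep A Z x ^ Suc 1)
      \<le> Suc 1 * harm n * (real t ^ Suc 1 * real (card {x \<in> Y. t \<le> shift_rep A Z x}))"
    by (rule power_sum_le_level_set[OF finY n1 le, where k = 1])
  define X where "X = {x \<in> Y. t \<le> shift_rep A Z x}"
  have finX: "finite X" using finY by (simp add: X_def)
  define F where "F x = {t \<in> A \<times> Z. fst t - snd t = x}" for x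
  have finF: "finite (F x)" for x using fin by (auto simp: F_def)
  have "card X * t = (\<Sum>x\<in>X. t)" by simp
  also have "\<dots> \<le> (\<Sum>x\<in>X. card (F x))"
    by (intro sum_mono) (auto simp: X_def F_def shift_rep_def)
  also have "\<dots> = card (Sigma X F)" using finX finF by simp
  also have "\<dots> \<le> card (A \<times> Z)"
    using fin by (intro card_inj_on_le[where f = snd]) (auto simp: inj_on_def F_def)
  finally have 1: "real t * real (card X) \<le> real n * real (card Z)"
    by (simp add: card_cartesian_product n_def mult.commute flip: of_nat_mult)
  have "U \<noteq> {}" using U(1,2) fin by force
  then have 2: "real n * (real (card X) * real t ^ 3) \<le> 21632 * H ^ 3 * (real (card Q) * real (card Z))\<^sup>2"
    using card_popular_shifts_le[OF fin finX zero _ U(3), of t] U(2)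
    by (auto simp: n_def H_def X_def)
  have E1: "real (energy A Z) \<le> 2 * H * ((real t)\<^sup>2 * real (card X))"
    using t(2) by (simp add: E H_def X_def numeral_2_eq_2)
  have "real n * (real (energy A Z))\<^sup>2 \<le> real n * (2 * H * ((real t)\<^sup>2 * real (card X)))\<^sup>2"
    using E1 by (intro mult_left_mono power_mono) auto
  also have "\<dots> = 4 * H\<^sup>2 * ((real t * real (card X)) * (real n * (real (card X) * real t ^ 3)))"
    by (simp add: power2_eq_square power3_eq_cube)
  also have "\<dots> \<le> 4 * H\<^sup>2 * ((real n * real (card Z)) * (21632 * H ^ 3 * (real (card Q) * real (card Z))\<^sup>2))"
    by (intro mult_left_mono mult_mono[OF 1 2]) auto
  also have "\<dots> = real n * (86528 * H ^ 5 * real (card Q) ^ 2 * real (card Z) ^ 3)"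
    by (simp add: power2_eq_square power3_eq_cube power_numeral_reduce)
  finally have "(real (energy A Z))\<^sup>2 \<le> 86528 * H ^ 5 * real (card Q) ^ 2 * real (card Z) ^ 3"
    by (rule mult_left_le_imp_le) (use n1 in simp)
  then show ?thesis by (simp add: H_def n_def)
qed

section \<open>Third energy\<close>

definition energy3 :: "complex set \<Rightarrow> nat" where
  "energy3 A = (\<Sum>w\<in>difference_set A. rep A w ^ 3)"

lemma difference_set_image: "difference_set A = (\<lambda>(a, b). a - b) ` (A \<times> A)"
  by (auto simp: difference_set_def)

lemma finite_difference_set: "finite A \<Longrightarrow> finite (difference_set A)"
  by (simp add: difference_set_image)

lemma difference_setI: "a \<in> A \<Longrightarrow> b \<in> A \<Longrightarrow> a - b \<in> difference_set A"
  by (auto simp: difference_set_def)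

lemma card_popular_pairs_ge:
  assumes "finite A" "A \<noteq> {}"
  defines "d \<equiv> card (difference_set A)"
  shows "(card A)\<^sup>2 \<le> 2 * card {(a, b) \<in> A \<times> A. (card A)\<^sup>2 \<le> 2 * d * rep A (a - b)}"
proof -
  let ?D = "difference_set A"
  define P where "P = {(a, b) \<in> A \<times> A. (card A)\<^sup>2 \<le> 2 * d * rep A (a - b)}"
  define C where "C = {x \<in> ?D. 2 * d * rep A x < (card A)\<^sup>2}"
  have finD: "finite ?D" using assms by (simp add: finite_difference_set)
  have "?D \<noteq> {}" using assms(2) by (auto simp: difference_set_image)
  then have d0: "d > 0" using finD by (simp add: d_def card_gt_0_iff)
  have finC: "finite C" using finD by (simp add: C_def)
  have "card (A \<times> A - P) \<le> card (Sigma C (\<lambda>x. {b \<in> A. b + x \<in> A}))"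
    using assms finC
    by (intro card_inj_on_le[where f = "\<lambda>(a, b). (a - b, b)"])
       (auto simp: inj_on_def P_def C_def difference_setI not_le)
  also have "\<dots> = (\<Sum>x\<in>C. rep A x)" using assms finC by (simp add: rep_def)
  finally have "2 * d * card (A \<times> A - P) \<le> (\<Sum>x\<in>C. 2 * d * rep A x)"
    by (simp add: sum_distrib_left[symmetric])
  also have "\<dots> \<le> (\<Sum>x\<in>C. (card A)\<^sup>2)" by (intro sum_mono) (auto simp: C_def)
  also have "\<dots> \<le> d * (card A)\<^sup>2"
    using card_mono[OF finD, of C] by (simp add: C_def d_def)
  finally have "2 * card (A \<times> A - P) \<le> (card A)\<^sup>2" using d0 by simp
  moreover have "card (A \<times> A - P) = (card A)\<^sup>2 - card P"
    using assms by (subst card_Diff_subset) (auto simp: P_def card_cartesian_product power2_eq_square intro: finite_subset[of _ "A \<times> A"])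
  ultimately show ?thesis unfolding P_def by linarith
qed

text \<open>The Schoen--Shkredov inequality: by Cauchy--Schwarz the triples \<open>(a, b, c)\<close> produce many
  pairs \<open>(a - b, b - c)\<close>, that is, many solutions of \<open>x + y = z\<close> in the difference set.\<close>

theorem card_pow8_le_energies:
  assumes "finite A" "A \<noteq> {}"
  defines "D \<equiv> difference_set A"
  shows "card A ^ 8 \<le> 8 * card D * energy3 A * energy A D"
proof -
  define n d where "n = card A" and "d = card D"
  have finD: "finite D" using assms by (simp add: finite_difference_set)
  define P where "P = {(a, b) \<in> A \<times> A. n\<^sup>2 \<le> 2 * d * rep A (a - b)}"
  have P: "n\<^sup>2 \<le> 2 * card P" using card_popular_pairs_ge[OF assms(1,2)] by (simp add: P_def n_def d_def D_def)
  define T where "T = P \<times> A"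
  have finT: "finite T" using assms by (auto simp: T_def P_def intro: finite_subset[of _ "A \<times> A"])
  define \<phi> where "\<phi> = (\<lambda>((a, b), c). (a - b, b - c :: complex))"
  define R where "R x = {b \<in> A. b + x \<in> A}" for x
  have finR: "finite (R x)" for x using assms by (simp add: R_def)
  have "card {(t, t'). t \<in> T \<and> t' \<in> T \<and> \<phi> t = \<phi> t'} \<le> card (Sigma D (\<lambda>w. R w \<times> R w \<times> R w))"
  proof (rule card_inj_on_le[where f = "\<lambda>(((a, b), c), ((a', b'), c')). (a - a', a', b', c')"])
    show "inj_on (\<lambda>(((a, b), c), ((a', b'), c')). (a - a', a', b', c')) {(t, t'). t \<in> T \<and> t' \<in> T \<and> \<phi> t = \<phi> t'}"
    proof (rule inj_onI)
      fix s t assume h: "s \<in> {(t, t'). t \<in> T \<and> t' \<in> T \<and> \<phi> t = \<phi> t'}" "t \<in> {(t, t'). t \<in> T \<and> t' \<in> T \<and> \<phi> t = \<phi> t'}"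
        "(\<lambda>(((a, b), c), ((a', b'), c')). (a - a', a', b', c')) s = (\<lambda>(((a, b), c), ((a', b'), c')). (a - a', a', b', c')) t"
      obtain a b c a' b' c' where s: "s = (((a, b), c), ((a', b'), c'))" by (metis surj_pair)
      obtain e f g e' f' g' where t: "t = (((e, f), g), ((e', f'), g'))" by (metis surj_pair)
      have 1: "a = e" "a' = e'" "b' = f'" "c' = g'" using h(3) by (auto simp: s t)
      have 2: "a - b = a' - b'" "b - c = b' - c'" "e - f = e' - f'" "f - g = f' - g'"
        using h(1,2) by (auto simp: s t \<phi>_def)
      have "e - b = e - f" using 1 2(1,3) by metis
      then have "b = f" by simp
      have "f - c = f - g" using 1 2(2,4) \<open>b = f\<close> by metis
      then have "c = g" by simp
      then show "s = t" using 1 \<open>b = f\<close> by (simp add: s t)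
    qed
    show "(\<lambda>(((a, b), c), ((a', b'), c')). (a - a', a', b', c')) ` {(t, t'). t \<in> T \<and> t' \<in> T \<and> \<phi> t = \<phi> t'}
        \<subseteq> Sigma D (\<lambda>w. R w \<times> R w \<times> R w)"
    proof (rule image_subsetI)
      fix s assume s: "s \<in> {(t, t'). t \<in> T \<and> t' \<in> T \<and> \<phi> t = \<phi> t'}"
      obtain a b c a' b' c' where s': "s = (((a, b), c), ((a', b'), c'))" by (metis surj_pair)
      have h: "((a, b), c) \<in> T" "((a', b'), c') \<in> T" "\<phi> ((a, b), c) = \<phi> ((a', b'), c')"
        using s by (auto simp: s')
      have b: "a - a' = b - b'" using h(3) by (auto simp: \<phi>_def algebra_simps)
      have c: "b - b' = c - c'" using h(3) by (auto simp: \<phi>_def algebra_simps)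
      have "b' + (a - a') = b" unfolding b by simp
      moreover have "c' + (a - a') = c" unfolding b c by simp
      ultimately show "(\<lambda>(((a, b), c), ((a', b'), c')). (a - a', a', b', c')) s \<in> Sigma D (\<lambda>w. R w \<times> R w \<times> R w)"
        using h(1,2) by (auto simp: s' T_def P_def R_def D_def difference_setI)
    qed
    show "finite (Sigma D (\<lambda>w. R w \<times> R w \<times> R w))" using finD finR by auto
  qed
  also have "\<dots> = energy3 A"
    using finD finR by (simp add: card_cartesian_product energy3_def rep_def R_def power3_eq_cube mult.assoc flip: D_def)
  finally have "(card T)\<^sup>2 \<le> card (\<phi> ` T) * energy3 A"
    using card_squared_le_fibre_pairs[OF finT, of \<phi>] by (meson le_trans mult_le_mono2)
  moreover have "n ^ 6 \<le> 4 * (card T)\<^sup>2"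
  proof -
    have "n ^ 3 \<le> 2 * card T"
      using mult_le_mono1[OF P, of n] by (simp add: T_def card_cartesian_product n_def power2_eq_square power3_eq_cube)
    then have "(n ^ 3)\<^sup>2 \<le> (2 * card T)\<^sup>2" by (rule power_mono) simp
    then show ?thesis by (simp add: power_mult_distrib flip: power_mult)
  qed
  ultimately have 1: "n ^ 6 \<le> 4 * (card (\<phi> ` T) * energy3 A)" by linarith
  have "n\<^sup>2 * card (\<phi> ` T) = (\<Sum>s\<in>\<phi> ` T. n\<^sup>2)" by simp
  also have "\<dots> \<le> (\<Sum>s\<in>\<phi> ` T. 2 * d * card (R (fst s)))"
    by (intro sum_mono) (auto simp: T_def P_def \<phi>_def rep_def R_def)
  also have "\<dots> = 2 * d * card (Sigma (\<phi> ` T) (\<lambda>s. R (fst s)))"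
    using finT finR by (simp add: sum_distrib_left)
  also have "card (Sigma (\<phi> ` T) (\<lambda>s. R (fst s))) \<le> energy A D"
    unfolding energy_def
  proof (rule card_inj_on_le[where f = "\<lambda>(s, b). ((b + fst s, fst s + snd s), (b, snd s))"])
    show "inj_on (\<lambda>(s, b). ((b + fst s, fst s + snd s), (b, snd s))) (Sigma (\<phi> ` T) (\<lambda>s. R (fst s)))"
      by (auto simp: inj_on_def prod_eq_iff)
    show "(\<lambda>(s, b). ((b + fst s, fst s + snd s), (b, snd s))) ` Sigma (\<phi> ` T) (\<lambda>s. R (fst s))
      \<subseteq> {(t, t'). t \<in> A \<times> D \<and> t' \<in> A \<times> D \<and> fst t - snd t = fst t' - snd t'}"
      by (auto simp: \<phi>_def T_def P_def R_def D_def difference_setI)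
    show "finite {(t, t'). t \<in> A \<times> D \<and> t' \<in> A \<times> D \<and> fst t - snd t = fst t' - snd t'}"
      by (rule finite_subset[of _ "(A \<times> D) \<times> (A \<times> D)"]) (use assms(1) finD in auto)
  qed
  finally have 2: "n\<^sup>2 * card (\<phi> ` T) \<le> 2 * d * energy A D" by simp
  have "n ^ 8 = n\<^sup>2 * n ^ 6" by (simp flip: power_add)
  also have "\<dots> \<le> n\<^sup>2 * (4 * (card (\<phi> ` T) * energy3 A))" using 1 by (rule mult_le_mono2)
  also have "\<dots> = 4 * energy3 A * (n\<^sup>2 * card (\<phi> ` T))" by simp
  also have "\<dots> \<le> 4 * energy3 A * (2 * d * energy A D)" using 2 by (rule mult_le_mono2)
  finally show ?thesis by (simp add: n_def d_def algebra_simps)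
qed

section \<open>Differences versus products and ratios\<close>

lemma energy3_pow4_le:
  fixes p :: real
  assumes A: "finite A" "0 \<notin> A" "A \<noteq> {}"
    and p: "0 \<le> p" "p \<le> (real (card A))\<^sup>2"
    and energy: "\<And>B. B \<subseteq> A \<Longrightarrow> real (card B) ^ 4 \<le> p * real (\<Sum>q\<in>slopes B. (mult_rep B q)\<^sup>2)"
  shows "real (energy3 A) ^ 4 \<le> 648 * 21632 ^ 3 * harm ((card A)\<^sup>2) ^ 32 * p ^ 3 * real (card A) ^ 10"
proof -
  let ?D = "difference_set A"
  define n where "n = card A"
  define H :: real where "H = harm (n\<^sup>2)"
  have n1: "1 \<le> n" using A by (simp add: n_def Suc_le_eq card_gt_0_iff)
  have Hn: "harm n \<le> H" unfolding H_def by (rule harm_mono) (simp add: power2_eq_square)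
  have H1: "1 \<le> H" using harm_ge_one[OF n1] Hn by linarith
  have finD: "finite ?D" using A by (simp add: finite_difference_set)
  have Dle: "card ?D \<le> n\<^sup>2"
    unfolding difference_set_image n_def using A card_image_le[of "A \<times> A" "\<lambda>(a, b). a - b"]
    by (simp add: card_cartesian_product power2_eq_square)
  have le: "rep A w \<le> n" for w unfolding rep_def n_def using A by (intro card_mono) auto
  obtain t where t: "t \<in> {1..n}"
    "real (\<Sum>w\<in>?D. rep A w ^ Suc 2) \<le> Suc 2 * harm n * (real t ^ Suc 2 * real (card {w \<in> ?D. t \<le> rep A w}))"
    by (rule power_sum_le_level_set[OF finD n1 le, where k = 2])
  define W where "W = {w \<in> ?D. t \<le> rep A w}"
  have W: "finite W" "card W \<le> n\<^sup>2"
    using finD Dle card_mono[OF finD, of W] by (auto simp: W_def)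
  have "real (energy3 A) \<le> 3 * harm n * (real t ^ 3 * real (card W))"
    using t(2) by (simp add: energy3_def W_def numeral_3_eq_3 numeral_2_eq_2)
  also have "\<dots> \<le> 3 * H * (real t ^ 3 * real (card W))"
    using Hn by (intro mult_right_mono) auto
  finally have "real (energy3 A) ^ 4 \<le> (3 * H * (real t ^ 3 * real (card W))) ^ 4"
    by (intro power_mono) auto
  also have "\<dots> = 81 * H ^ 4 * (real (card W) ^ 4 * real t ^ 12)"
    by (simp add: power_mult_distrib flip: power_mult)
  also have "\<dots> \<le> 81 * H ^ 4 * (8 * 21632 ^ 3 * H ^ 28 * p ^ 3 * real n ^ 10)"
    unfolding H_def n_def
    by (intro mult_left_mono card_popular_differences_le energy)
       (use A p W in \<open>auto simp: W_def n_def harm_nonneg\<close>)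
  also have "\<dots> = 648 * 21632 ^ 3 * (H ^ 4 * H ^ 28) * p ^ 3 * real n ^ 10" by simp
  also have "H ^ 4 * H ^ 28 = H ^ 32" by (simp flip: power_add)
  finally show ?thesis by (simp add: H_def n_def)
qed

theorem card_pow22_le:
  assumes A: "finite A" "0 \<notin> A" "A \<noteq> {}" and fin: "finite U" "finite Q"
    and zero: "0 \<notin> U" "0 \<notin> Q" and U: "card U = card A" "\<And>a u. a \<in> A \<Longrightarrow> u \<in> U \<Longrightarrow> a / u \<in> Q"
    and Q: "card Q \<le> (card A)\<^sup>2"
    and energy: "\<And>B. B \<subseteq> A \<Longrightarrow> card B ^ 4 \<le> card Q * (\<Sum>q\<in>slopes B. (mult_rep B q)\<^sup>2)"
  shows "real (card A) ^ 22 \<le> 4096 * 648 * 21632 ^ 3 * 86528\<^sup>2 *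
    harm ((card A)\<^sup>2) ^ 42 * real (card Q) ^ 7 * real (card (difference_set A)) ^ 10"
proof -
  define n d p where "n = real (card A)" and "d = real (card (difference_set A))" and "p = real (card Q)"
  define H :: real where "H = harm ((card A)\<^sup>2)"
  define E3 E where "E3 = real (energy3 A)" and "E = real (energy A (difference_set A))"
  have n0: "0 < n" using A by (simp add: n_def card_gt_0_iff)
  have Hn: "harm (card A) \<le> H" unfolding H_def by (rule harm_mono) (simp add: power2_eq_square)
  have H0: "0 \<le> H" by (simp add: H_def harm_nonneg)
  have nn: "0 \<le> d" "0 \<le> p" "0 \<le> E3" "0 \<le> E" by (simp_all add: d_def p_def E3_def E_def)
  have e3: "E3 ^ 4 \<le> 648 * 21632 ^ 3 * H ^ 32 * p ^ 3 * n ^ 10"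
    unfolding E3_def H_def n_def
  proof (rule energy3_pow4_le[OF A])
    show "p \<le> (real (card A))\<^sup>2" using Q unfolding p_def by (simp flip: of_nat_power)
    show "real (card B) ^ 4 \<le> p * real (\<Sum>q\<in>slopes B. (mult_rep B q)\<^sup>2)" if "B \<subseteq> A" for B
      using energy[OF that] unfolding p_def by (simp only: of_nat_le_iff flip: of_nat_power of_nat_mult)
  qed (use nn in auto)
  have "E\<^sup>2 \<le> 86528 * harm (card A) ^ 5 * p\<^sup>2 * d ^ 3"
    unfolding E_def p_def d_def
    using A fin zero U by (intro energy_squared_le[where U = U]) (auto simp: finite_difference_set)
  also have "\<dots> \<le> 86528 * H ^ 5 * p\<^sup>2 * d ^ 3"
    using Hn nn by (intro mult_right_mono mult_left_mono power_mono) (auto simp: harm_nonneg)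
  finally have e2: "E\<^sup>2 \<le> 86528 * H ^ 5 * p\<^sup>2 * d ^ 3" .
  have "real (card A ^ 8) \<le> real (8 * card (difference_set A) * energy3 A * energy A (difference_set A))"
    using card_pow8_le_energies[OF A(1,3)] by (simp only: of_nat_le_iff)
  then have e1: "n ^ 8 \<le> 8 * d * E3 * E" by (simp add: n_def d_def E3_def E_def)
  have "n ^ 10 * n ^ 22 = (n ^ 8) ^ 4" by (simp flip: power_add power_mult)
  also have "\<dots> \<le> (8 * d * E3 * E) ^ 4" using e1 n0 by (intro power_mono) auto
  also have "\<dots> = 4096 * d ^ 4 * (E3 ^ 4 * (E\<^sup>2)\<^sup>2)" by (simp add: power_mult_distrib flip: power_mult)
  also have "\<dots> \<le> 4096 * d ^ 4 * ((648 * 21632 ^ 3 * H ^ 32 * p ^ 3 * n ^ 10) * (86528 * H ^ 5 * p\<^sup>2 * d ^ 3)\<^sup>2)"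
    using nn H0 n0 by (intro mult_left_mono mult_mono[OF e3 power_mono[OF e2]]) auto
  also have "\<dots> = n ^ 10 * (4096 * 648 * 21632 ^ 3 * 86528\<^sup>2 * (H ^ 32 * (H ^ 5)\<^sup>2) * (p ^ 3 * (p\<^sup>2)\<^sup>2) * (d ^ 4 * (d ^ 3)\<^sup>2))"
    by (simp only: power_mult_distrib mult_ac)
  also have "\<dots> = n ^ 10 * (4096 * 648 * 21632 ^ 3 * 86528\<^sup>2 * H ^ 42 * p ^ 7 * d ^ 10)"
  proof -
    have "H ^ 32 * (H ^ 5)\<^sup>2 = H ^ 42" "p ^ 3 * (p\<^sup>2)\<^sup>2 = p ^ 7" "d ^ 4 * (d ^ 3)\<^sup>2 = d ^ 10"
      by (simp_all flip: power_add power_mult)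
    then show ?thesis by (simp only:)
  qed
  finally have "n ^ 22 \<le> 4096 * 648 * 21632 ^ 3 * 86528\<^sup>2 * H ^ 42 * p ^ 7 * d ^ 10"
    by (rule mult_left_le_imp_le) (use n0 in simp)
  then show ?thesis by (simp only: n_def H_def p_def d_def)
qed

lemma card_pow4_le_mult_energy:
  assumes "finite B" "0 \<notin> B"
  shows "card B ^ 4 \<le> card (slopes B) * (\<Sum>q\<in>slopes B. (mult_rep B q)\<^sup>2)"
    and "card B ^ 4 \<le> card (product_set B) * (\<Sum>q\<in>slopes B. (mult_rep B q)\<^sup>2)"
proof -
  define r where "r = (\<lambda>(a, b). b / a :: complex)"
  have fibre: "card {t \<in> B \<times> B. r t = q} = mult_rep B q" for q
    unfolding mult_rep_def
    by (rule bij_betw_same_card[of fst])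
       (rule bij_betwI[where g = "\<lambda>a. (a, q * a)"]; use assms in \<open>auto simp: r_def field_simps\<close>)
  have sl: "slopes B = r ` (B \<times> B)" by (simp add: slopes_def r_def)
  have pairs: "card {(t, t'). t \<in> B \<times> B \<and> t' \<in> B \<times> B \<and> r t = r t'} = (\<Sum>q\<in>slopes B. (mult_rep B q)\<^sup>2)"
    using card_eq_fibre_pairs[of "B \<times> B" r] assms by (simp add: fibre sl)
  have four: "(card (B \<times> B))\<^sup>2 = card B ^ 4"
    by (simp add: card_cartesian_product power2_eq_square power4_eq_xxxx)
  show "card B ^ 4 \<le> card (slopes B) * (\<Sum>q\<in>slopes B. (mult_rep B q)\<^sup>2)"
    using card_squared_le_fibre_pairs[of "B \<times> B" r] assms four pairs by (simp add: sl)
  define m where "m = (\<lambda>(a, b). a * b :: complex)"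
  have im: "m ` (B \<times> B) = product_set B" by (auto simp: m_def product_set_def)
  have "card {(t, t'). t \<in> B \<times> B \<and> t' \<in> B \<times> B \<and> m t = m t'}
      \<le> card {(t, t'). t \<in> B \<times> B \<and> t' \<in> B \<times> B \<and> r t = r t'}"
  proof (rule card_inj_on_le[where f = "\<lambda>((a, b), (c, e)). ((a, c), (e, b))"])
    show "inj_on (\<lambda>((a, b), (c, e)). ((a, c), (e, b))) {(t, t'). t \<in> B \<times> B \<and> t' \<in> B \<times> B \<and> m t = m t'}"
      by (auto simp: inj_on_def)
    show "(\<lambda>((a, b), (c, e)). ((a, c), (e, b))) ` {(t, t'). t \<in> B \<times> B \<and> t' \<in> B \<times> B \<and> m t = m t'}
        \<subseteq> {(t, t'). t \<in> B \<times> B \<and> t' \<in> B \<times> B \<and> r t = r t'}"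
    proof clarsimp
      fix a b c e assume h: "a \<in> B" "b \<in> B" "c \<in> B" "e \<in> B" "m (a, b) = m (c, e)"
      then have "a \<noteq> 0" "e \<noteq> 0" using assms by auto
      then show "r (a, c) = r (e, b)" using h(5) by (simp add: r_def m_def field_simps)
    qed
    show "finite {(t, t'). t \<in> B \<times> B \<and> t' \<in> B \<times> B \<and> r t = r t'}"
      by (rule finite_subset[of _ "(B \<times> B) \<times> (B \<times> B)"]) (use assms in auto)
  qed
  then have "(card (B \<times> B))\<^sup>2 \<le> card (product_set B) * (\<Sum>q\<in>slopes B. (mult_rep B q)\<^sup>2)"
    using card_squared_le_fibre_pairs[of "B \<times> B" m] assms im pairs
    by (simp) (meson le_trans mult_le_mono2)
  then show "card B ^ 4 \<le> card (product_set B) * (\<Sum>q\<in>slopes B. (mult_rep B q)\<^sup>2)" by (simp only: four)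
qed

lemma ratio_set_eq_slopes: "0 \<notin> A \<Longrightarrow> ratio_set A = slopes A"
  by (force simp: ratio_set_def slopes_def)

lemma card_pow22_le_product_ratio:
  assumes A: "finite A" "0 \<notin> A" "A \<noteq> {}" and Q: "Q = ratio_set A \<or> Q = product_set A"
  shows "real (card A) ^ 22 \<le> 4096 * 648 * 21632 ^ 3 * 86528\<^sup>2 *
    harm ((card A)\<^sup>2) ^ 42 * real (card Q) ^ 7 * real (card (difference_set A)) ^ 10"
  using Q
proof
  assume Q: "Q = ratio_set A"
  then have Q': "Q = slopes A" using A by (simp add: ratio_set_eq_slopes)
  show ?thesis
  proof (rule card_pow22_le[OF A A(1)])
    show "card B ^ 4 \<le> card Q * (\<Sum>q\<in>slopes B. (mult_rep B q)\<^sup>2)" if "B \<subseteq> A" for B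
    proof -
      have B: "finite B" "0 \<notin> B" using A that finite_subset by auto
      have "card (slopes B) \<le> card Q"
        unfolding Q' using that A by (intro card_mono) (auto simp: slopes_def)
      then show ?thesis using card_pow4_le_mult_energy(1)[OF B] by (meson le_trans mult_le_mono1)
    qed
    show "card Q \<le> (card A)\<^sup>2"
      unfolding Q' slopes_def using A card_image_le[of "A \<times> A" "\<lambda>(a, b). b / a"]
      by (simp add: card_cartesian_product power2_eq_square)
  qed (use A in \<open>auto simp: Q' slopes_def\<close>)
next
  assume Q: "Q = product_set A"
  have im: "Q = (\<lambda>(a, b). a * b) ` (A \<times> A)" by (auto simp: Q product_set_def)
  show ?thesis
  proof (rule card_pow22_le[OF A, of "inverse ` A"])
    show "card B ^ 4 \<le> card Q * (\<Sum>q\<in>slopes B. (mult_rep B q)\<^sup>2)" if "B \<subseteq> A" for B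
    proof -
      have B: "finite B" "0 \<notin> B" using A that finite_subset by auto
      have "card (product_set B) \<le> card Q"
        using that A by (intro card_mono) (auto simp: im product_set_def)
      then show ?thesis using card_pow4_le_mult_energy(2)[OF B] by (meson le_trans mult_le_mono1)
    qed
    show "card Q \<le> (card A)\<^sup>2"
      unfolding im using A card_image_le[of "A \<times> A" "\<lambda>(a, b). a * b"]
      by (simp add: card_cartesian_product power2_eq_square)
    show "card (inverse ` A) = card A" by (simp add: card_image inj_on_def)
    show "a / u \<in> Q" if "a \<in> A" "u \<in> inverse ` A" for a u
      using that by (auto simp: im divide_inverse)
  qed (use A in \<open>auto simp: im\<close>)
qed

lemma harm_le_ln: "1 \<le> n \<Longrightarrow> harm n \<le> 1 + ln (real n)"
proof -
  assume "1 \<le> n"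
  then obtain m where m: "n = Suc m" by (cases n) auto
  have "harm (Suc m) - ln (real (Suc m)) \<le> harm (Suc 0) - ln (real (Suc 0))"
    using decseqD[OF decseq_harm_diff_ln, of 0 m] by simp
  then show ?thesis by (simp add: m harm_expand)
qed

text \<open>The exponent is chosen such that \<open>42/651 = 22 - 17 \<cdot> 40/31\<close>.\<close>

lemma harm_square_le: "1 \<le> n \<Longrightarrow> harm (n\<^sup>2) \<le> 1303 * real n powr (1/651)"
proof -
  assume n: "1 \<le> n"
  have "harm (n\<^sup>2) \<le> 1 + 2 * ln (real n)"
    using harm_le_ln[of "n\<^sup>2"] n by (simp add: ln_realpow)
  also have "\<dots> \<le> real n powr (1/651) + 2 * (real n powr (1/651) / (1/651))"
    using n ln_powr_bound[of "real n" "1/651"] ge_one_powr_ge_zero[of "real n" "1/651"] by (intro add_mono) auto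
  finally show ?thesis by simp
qed

lemma powr_le_sum_if_pow22_le:
  fixes x K H p d s :: real
  assumes "1 \<le> x" "0 \<le> K" "0 \<le> H" "H \<le> 1303 * x powr (1/651)" "0 \<le> p" "p \<le> s" "0 \<le> d" "d \<le> s"
    and le: "x ^ 22 \<le> K * H ^ 42 * p ^ 7 * d ^ 10"
  shows "x powr (40/31) \<le> (K * 1303 ^ 42 + 1) * s"
proof -
  have s0: "0 \<le> s" using assms by linarith
  have "H ^ 42 \<le> (1303 * x powr (1/651)) ^ 42" using assms by (intro power_mono) auto
  also have "\<dots> = 1303 ^ 42 * x powr (2/31)"
    using assms(1) by (simp add: power_mult_distrib powr_power)
  finally have H: "H ^ 42 \<le> 1303 ^ 42 * x powr (2/31)" .
  have "x powr (2/31) * x powr (680/31) = x ^ 22"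
    using assms(1) by (simp add: powr_add[symmetric])
  also have "\<dots> \<le> K * (1303 ^ 42 * x powr (2/31)) * s ^ 7 * s ^ 10"
    using assms H s0 by (intro order_trans[OF le] mult_mono power_mono) auto
  also have "\<dots> = x powr (2/31) * (K * 1303 ^ 42 * s ^ 17)"
    by (simp add: mult.assoc flip: power_add)
  finally have "x powr (680/31) \<le> K * 1303 ^ 42 * s ^ 17"
    by (rule mult_left_le_imp_le) (use assms in simp)
  also have "\<dots> \<le> (K * 1303 ^ 42 + 1) ^ 17 * s ^ 17"
    using assms s0 self_le_power[of "K * 1303 ^ 42 + 1" 17] by (intro mult_right_mono) auto
  also have "x powr (680/31) = (x powr (40/31)) ^ 17" using assms(1) by (simp add: powr_power)
  finally have "(x powr (40/31)) ^ 17 \<le> ((K * 1303 ^ 42 + 1) * s) ^ 17" by (simp only: power_mult_distrib)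
  then show ?thesis by (rule power_le_imp_le_base[where n = 16, simplified]) (use assms s0 in auto)
qed

definition sum_product_constant :: real where
  "sum_product_constant = 4096 * 648 * 21632 ^ 3 * 86528\<^sup>2 * 1303 ^ 42 + 1"

lemma card_powr_le_sum:
  assumes A: "finite A" "card A \<ge> 2"
    and Q: "Q = ratio_set A \<or> Q = product_set A"
  shows "real (card A) powr (40/31)
    \<le> 4 * sum_product_constant * (real (card (difference_set A)) + real (card Q))"
proof -
  define B where "B = A - {0}"
  define R where "R = (if Q = ratio_set A then ratio_set B else product_set B)"
  have B: "finite B" "0 \<notin> B" using A by (auto simp: B_def)
  have cB: "card A \<le> 2 * card B" using A by (cases "0 \<in> A") (auto simp: B_def)
  then have B1: "1 \<le> card B" "B \<noteq> {}" using A by auto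
  have finQ: "finite Q"
  proof -
    have "ratio_set A \<subseteq> (\<lambda>(a, b). a / b) ` (A \<times> A)" "product_set A \<subseteq> (\<lambda>(a, b). a * b) ` (A \<times> A)"
      by (auto simp: ratio_set_def product_set_def)
    then show ?thesis using A Q finite_subset by blast
  qed
  have "R \<subseteq> Q" using Q by (auto simp: R_def ratio_set_def product_set_def B_def)
  then have RQ: "card R \<le> card Q" using finQ by (intro card_mono)
  have "difference_set B \<subseteq> difference_set A" by (auto simp: difference_set_def B_def)
  then have DD: "card (difference_set B) \<le> card (difference_set A)"
    using A by (intro card_mono finite_difference_set)
  have le: "real (card B) powr (40/31)
      \<le> sum_product_constant * (real (card (difference_set A)) + real (card Q))"
    unfolding sum_product_constant_def
    by (rule powr_le_sum_if_pow22_le[OF _ _ _ harm_square_le _ _ _ _ card_pow22_le_product_ratio[of B R]])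
       (use B B1 RQ DD in \<open>auto simp: R_def harm_nonneg\<close>)
  have "real (card A) powr (40/31) \<le> (2 * real (card B)) powr (40/31)"
    using cB by (intro powr_mono2) auto
  also have "\<dots> = 2 powr (40/31) * real (card B) powr (40/31)" by (simp add: powr_mult)
  also have "\<dots> \<le> 4 * real (card B) powr (40/31)"
    using powr_mono[of "40/31" 2 "2::real"] by (intro mult_right_mono) auto
  finally show ?thesis using le by simp
qed

lemma powr_div_ln_powr_le:
  assumes "2 \<le> x" "0 \<le> a" "a \<le> 1" "e \<le> (40/31::real)"
  shows "x powr e / ln x powr a \<le> 2 * x powr (40/31)"
proof -
  have "1/2 \<le> ln (2::real)" using ln2_ge_two_thirds by simp
  then have "1/2 \<le> ln x" using assms(1) ln_mono[of 2 x] by linarith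
  have "(1/2::real) \<le> (1/2) powr a" using powr_mono'[of a 1 "1/2::real"] assms by simp
  also have "\<dots> \<le> ln x powr a" using \<open>1/2 \<le> ln x\<close> assms by (intro powr_mono2) auto
  finally have l: "1/2 \<le> ln x powr a" .
  have "x powr e / ln x powr a \<le> x powr (40/31) / (1/2)"
    using l assms by (intro frac_le powr_mono) auto
  then show ?thesis by simp
qed

theorem theorem2:
  shows "\<exists>c::real. c > 0 \<and>
    (\<forall>A::complex set. finite A \<and> card A \<ge> 2 \<longrightarrow>
      real (card (difference_set A)) + real (card (ratio_set A))
        \<ge> c * (real (card A) powr (1 + 9/31) / ln (real (card A)) powr (4/31)) \<and>
      real (card (difference_set A)) + real (card (product_set A))
        \<ge> c * (real (card A) powr (1 + 11/39) / ln (real (card A)) powr (5/13)))"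
proof (intro exI[of _ "inverse (8 * sum_product_constant)"] conjI allI impI)
  have pos: "sum_product_constant > 0" by (simp add: sum_product_constant_def)
  then show "inverse (8 * sum_product_constant) > 0" by simp
  fix A :: "complex set" assume A: "finite A \<and> card A \<ge> 2"
  have main: "inverse (8 * sum_product_constant) * (real (card A) powr e / ln (real (card A)) powr a)
      \<le> real (card (difference_set A)) + real (card Q)"
    if "Q = ratio_set A \<or> Q = product_set A" "0 \<le> a" "a \<le> 1" "e \<le> 40/31" for Q a e
  proof -
    have "real (card A) powr e / ln (real (card A)) powr a \<le> 2 * real (card A) powr (40/31)"
      using A that by (intro powr_div_ln_powr_le) auto
    also have "\<dots> \<le> 8 * sum_product_constant * (real (card (difference_set A)) + real (card Q))"
      using card_powr_le_sum[of A Q] A that by simp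
    finally have "inverse (8 * sum_product_constant) * (real (card A) powr e / ln (real (card A)) powr a)
        \<le> inverse (8 * sum_product_constant) *
          (8 * sum_product_constant * (real (card (difference_set A)) + real (card Q)))"
      using pos by (intro mult_left_mono) auto
    then show ?thesis using pos by (simp only: mult.assoc[symmetric]) simp
  qed
  show "inverse (8 * sum_product_constant) * (real (card A) powr (1 + 9/31) / ln (real (card A)) powr (4/31))
      \<le> real (card (difference_set A)) + real (card (ratio_set A))"
    by (rule main) auto
  show "inverse (8 * sum_product_constant) * (real (card A) powr (1 + 11/39) / ln (real (card A)) powr (5/13))
      \<le> real (card (difference_set A)) + real (card (product_set A))"
    by (rule main) auto
qed

end
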